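(* Let $N\in\mathbb{N}$ be fixed. If $\mathrm{NA}_{\pi,s,N}(Y)$ is dense in $\widehat{\otimes}_{\pi,s,N}Y$ for every separable Banach space $Y$, then $\mathrm{NA}_{\pi,s,N}(X)$ is dense in $\widehat{\otimes}_{\pi,s,N}X$ for every Banach space $X$.
   Context: All Banach spaces are over a field $\mathbb{K}$ which is $\mathbb{R}$ or $\mathbb{C}$; $B_X$ and $S_X$ are the closed unit ball and unit sphere of $X$. For $z\in X$, $z^N:=z\otimes\cdots\otimes z$ ($N$ times). The $N$-fold projective symmetric tensor product $\widehat{\otimes}_{\pi,s,N}X$ is the completion of the linear span of $\{z^N:z\in X\}$ under the norm $\|z\|_{\pi,s,N}=\inf\{\sum_{k=1}^n|\lambda_k|: z=\sum_{k=1}^n\lambda_k x_k^N,\ n\in\mathbb{N},\ x_k\in S_X,\ \lambda_k\in\mathbb{K}\}$. An element $z\in\widehat{\otimes}_{\pi,s,N}X$ attains its norm if there are bounded sequences $(\lambda_n)_{n=1}^\infty\subset\mathbb{K}$ and $(x_n)_{n=1}^\infty\subset B_X$ with $z=\sum_{n=1}^\infty\lambda_n x_n^N$ and $\|z\|_{\pi,s,N}=\sum_{n=1}^\infty|\lambda_n|$; the set of all such $z$ is denoted $\mathrm{NA}_{\pi,s,N}(X)$. Density is with respect to $\|\cdot\|_{\pi,s,N}$. *)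

theory Defs
  imports "HOL-Analysis.Analysis" "HOL-Algebra.Module"
begin

section \<open>Normed spaces on a carrier set\<close>

text \<open>
  The theorem has a quantifier over Banach spaces inside its hypothesis, so a space is a
  record value and not a type.  The type \<open>'a\<close> of its points, arbitrary, bounds the size of the
  spaces considered.  The scalar type \<open>'k\<close> is meant to be \<open>real\<close> or \<open>complex\<close>.  The fields \<open>mult\<close> and \<open>one\<close> that \<open>module\<close> inherits from \<open>ring\<close> play no role.
\<close>

record ('k, 'a) normed_space = "('k, 'a) module" +
  nrm :: "'a \<Rightarrow> real"

definition scalars :: "'k::field ring"
  where "scalars = \<lparr>carrier = UNIV, mult = (*), one = 1, zero = 0, add = (+)\<rparr>"

locale normed_space = Module.module scalars X
  for X :: "('k::real_normed_field, 'a) normed_space" (structure) +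
  assumes nrm_eq_zero_iff: "x \<in> carrier X \<Longrightarrow> nrm X x = 0 \<longleftrightarrow> x = \<zero>"
    and nrm_smult: "x \<in> carrier X \<Longrightarrow> nrm X (c \<odot> x) = norm c * nrm X x"
    and nrm_triangle:
      "x \<in> carrier X \<Longrightarrow> y \<in> carrier X \<Longrightarrow> nrm X (x \<oplus> y) \<le> nrm X x + nrm X y"

text \<open>
  The value \<open>0\<close> off the carrier is needed because \<^locale>\<open>Metric_space\<close> demands
  nonnegativity and symmetry on the whole type.
\<close>

definition ndist :: "('k, 'a) normed_space \<Rightarrow> 'a \<Rightarrow> 'a \<Rightarrow> real"
  where "ndist X x y = (if x \<in> carrier X \<and> y \<in> carrier X then nrm X (x \<ominus>\<^bsub>X\<^esub> y) else 0)"

abbreviation norm_topology :: "('k, 'a) normed_space \<Rightarrow> 'a topology"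
  where "norm_topology X \<equiv> Metric_space.mtopology (carrier X) (ndist X)"

definition banach_space :: "('k::real_normed_field, 'a) normed_space \<Rightarrow> bool"
  where "banach_space X \<longleftrightarrow>
    normed_space X \<and> Metric_space.mcomplete (carrier X) (ndist X)"

lemma cring_scalars: "cring (scalars :: 'k::field ring)"
proof (rule cringI)
  show "abelian_group (scalars :: 'k ring)"
  proof (rule abelian_groupI)
    fix x :: 'k
    show "\<exists>y\<in>carrier scalars. y \<oplus>\<^bsub>scalars\<^esub> x = \<zero>\<^bsub>scalars\<^esub>"
      by (rule bexI[of _ "- x"]) (simp_all add: scalars_def)
  qed (auto simp: scalars_def)
  show "Group.comm_monoid (scalars :: 'k ring)"
    by (rule Group.comm_monoidI) (auto simp: scalars_def)
qed (auto simp: scalars_def algebra_simps)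

context normed_space
begin

lemma nrm_minus:
  assumes "x \<in> carrier X" shows "nrm X (\<ominus> x) = nrm X x"
proof -
  have "\<ominus>\<^bsub>scalars\<^esub> (1::'k) = - 1"
    by (rule R.minus_equality) (auto simp: scalars_def)
  moreover have "\<ominus> x = (\<ominus>\<^bsub>scalars\<^esub> (1::'k)) \<odot> x"
    using smult_l_minus[of 1 x] smult_one[OF assms] assms by (simp add: scalars_def)
  ultimately show ?thesis using nrm_smult[OF assms, of "- 1"] by simp
qed

lemma nrm_nonneg:
  assumes "x \<in> carrier X" shows "0 \<le> nrm X x"
proof -
  have "0 = nrm X (x \<oplus> \<ominus> x)"
    using assms nrm_eq_zero_iff[of \<zero>] by (simp add: M.r_neg)
  also have "\<dots> \<le> nrm X x + nrm X (\<ominus> x)" using assms by (intro nrm_triangle) auto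
  finally show ?thesis using nrm_minus[OF assms] by simp
qed

lemma Metric_space_ndist: "Metric_space (carrier X) (ndist X)"
proof
  fix x y
  show "0 \<le> ndist X x y" by (simp add: ndist_def nrm_nonneg)
  show "ndist X x y = ndist X y x"
  proof (cases "x \<in> carrier X \<and> y \<in> carrier X")
    case True
    then have "y \<ominus> x = \<ominus> (x \<ominus> y)" by (simp add: M.minus_eq M.minus_add M.a_comm)
    then show ?thesis using True by (simp add: ndist_def nrm_minus)
  qed (auto simp: ndist_def)
next
  fix x y assume xy: "x \<in> carrier X" "y \<in> carrier X"
  have "x = y" if "x \<ominus> y = \<zero>"
  proof -
    have "x = (x \<ominus> y) \<oplus> y" using xy by (simp add: M.minus_eq M.a_assoc M.l_neg)
    then show ?thesis using that xy by simp
  qed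
  moreover have "y \<ominus> y = \<zero>" using xy by (simp add: M.minus_eq M.r_neg)
  ultimately show "ndist X x y = 0 \<longleftrightarrow> x = y"
    using xy by (auto simp: ndist_def nrm_eq_zero_iff)
next
  fix x y z assume "x \<in> carrier X" "y \<in> carrier X" "z \<in> carrier X"
  moreover from this have "x \<ominus> z = (x \<ominus> y) \<oplus> (y \<ominus> z)"
    by (simp add: M.minus_eq M.a_assoc M.r_neg1 M.r_neg2)
  ultimately show "ndist X x z \<le> ndist X x y + ndist X y z"
    using nrm_triangle[of "x \<ominus> y" "y \<ominus> z"] by (simp add: ndist_def)
qed

end

section \<open>Completion\<close>

text \<open>Cauchy sequences modulo null sequences.\<close>

definition cauchy_seqs :: "('k, 'a) normed_space \<Rightarrow> (nat \<Rightarrow> 'a) set"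
  where "cauchy_seqs X = {s. Metric_space.MCauchy (carrier X) (ndist X) s}"

definition null_rel :: "('k, 'a) normed_space \<Rightarrow> ((nat \<Rightarrow> 'a) \<times> (nat \<Rightarrow> 'a)) set"
  where "null_rel X =
    {(s, t). s \<in> cauchy_seqs X \<and> t \<in> cauchy_seqs X \<and> (\<lambda>n. ndist X (s n) (t n)) \<longlonglongrightarrow> 0}"

definition completion :: "('k, 'a) normed_space \<Rightarrow> ('k, (nat \<Rightarrow> 'a) set) normed_space"
  where "completion X =
    \<lparr>carrier = cauchy_seqs X // null_rel X,
     mult = undefined, one = undefined,
     zero = null_rel X `` {\<lambda>n. \<zero>\<^bsub>X\<^esub>},
     add = (\<lambda>S T. \<Union>s\<in>S. \<Union>t\<in>T. null_rel X `` {\<lambda>n. s n \<oplus>\<^bsub>X\<^esub> t n}),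
     smult = (\<lambda>c S. \<Union>s\<in>S. null_rel X `` {\<lambda>n. c \<odot>\<^bsub>X\<^esub> s n}),
     nrm = (\<lambda>S. THE r. \<forall>s\<in>S. (\<lambda>n. nrm X (s n)) \<longlonglongrightarrow> r)\<rparr>"

definition to_completion :: "('k, 'a) normed_space \<Rightarrow> 'a \<Rightarrow> (nat \<Rightarrow> 'a) set"
  where "to_completion X x = null_rel X `` {\<lambda>n. x}"

section \<open>The projective symmetric tensor product\<close>

text \<open>
  As in Ryan's book, tensors are linear functionals on multilinear forms:
  \<open>x\<^sub>1 \<otimes> \<dots> \<otimes> x\<^sub>N\<close> is evaluation at \<open>(x\<^sub>1, \<dots>, x\<^sub>N)\<close>.  All \<open>N\<close>-linear forms are used, bounded
  or not, so this is the algebraic tensor product.  An \<open>N\<close>-tuple is a list of length \<open>N\<close>; the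
  values of a form on other lists are irrelevant.  Tensors are \<open>0\<close> on functions that are not
  \<open>N\<close>-linear, which makes the pointwise operations the right ones.
\<close>

definition multilinear_forms ::
    "nat \<Rightarrow> ('k::real_normed_field, 'a) normed_space \<Rightarrow> ('a list \<Rightarrow> 'k) set"
  where "multilinear_forms N X =
    {A. \<forall>xs i x y a b. length xs = N \<longrightarrow> set xs \<subseteq> carrier X \<longrightarrow> i < N \<longrightarrow>
          x \<in> carrier X \<longrightarrow> y \<in> carrier X \<longrightarrow>
          A (xs[i := a \<odot>\<^bsub>X\<^esub> x \<oplus>\<^bsub>X\<^esub> b \<odot>\<^bsub>X\<^esub> y]) = a * A (xs[i := x]) + b * A (xs[i := y])}"

type_synonym ('k, 'a) tensor = "('a list \<Rightarrow> 'k) \<Rightarrow> 'k"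

definition elementary_tensor ::
    "('k::real_normed_field, 'a) normed_space \<Rightarrow> 'a list \<Rightarrow> ('k, 'a) tensor"
  where "elementary_tensor X xs =
    (\<lambda>A. if A \<in> multilinear_forms (length xs) X then A xs else 0)"

definition tensor_power ::
    "nat \<Rightarrow> ('k::real_normed_field, 'a) normed_space \<Rightarrow> 'a \<Rightarrow> ('k, 'a) tensor"
  where "tensor_power N X z = elementary_tensor X (replicate N z)"

definition power_comb ::
    "nat \<Rightarrow> ('k::real_normed_field, 'a) normed_space \<Rightarrow> nat \<Rightarrow> (nat \<Rightarrow> 'k) \<Rightarrow> (nat \<Rightarrow> 'a) \<Rightarrow>
     ('k, 'a) tensor"
  where "power_comb N X n c x = (\<lambda>A. \<Sum>k<n. c k * tensor_power N X (x k) A)"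

text \<open>
  The empty sum (\<open>n = 0\<close>) is admitted as a representation of \<open>0\<close>; this matters only for
  the zero space, whose unit sphere is empty.
\<close>

definition proj_sym_norm ::
    "nat \<Rightarrow> ('k::real_normed_field, 'a) normed_space \<Rightarrow> ('k, 'a) tensor \<Rightarrow> real"
  where "proj_sym_norm N X u =
    Inf {\<Sum>k<n. norm (c k) | n c x.
          (\<forall>k<n. x k \<in> carrier X \<and> nrm X (x k) = 1) \<and> u = power_comb N X n c x}"

definition sym_tensors ::
    "nat \<Rightarrow> ('k::real_normed_field, 'a) normed_space \<Rightarrow> ('k, ('k, 'a) tensor) normed_space"
  where "sym_tensors N X =
    \<lparr>carrier = {power_comb N X n c z | n c z. \<forall>k<n. z k \<in> carrier X},
     mult = undefined, one = undefined,
     zero = (\<lambda>A. 0),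
     add = (\<lambda>u v A. u A + v A),
     smult = (\<lambda>c u A. c * u A),
     nrm = proj_sym_norm N X\<rparr>"

definition proj_sym_tensor ::
    "nat \<Rightarrow> ('k::real_normed_field, 'a) normed_space \<Rightarrow>
     ('k, (nat \<Rightarrow> ('k, 'a) tensor) set) normed_space"
  where "proj_sym_tensor N X = completion (sym_tensors N X)"

definition norm_attaining ::
    "nat \<Rightarrow> ('k::real_normed_field, 'a) normed_space \<Rightarrow> (nat \<Rightarrow> ('k, 'a) tensor) set set"
  where "norm_attaining N X =
    {z \<in> carrier (proj_sym_tensor N X).
       \<exists>c x. bounded (range c) \<and> (\<forall>n. x n \<in> carrier X \<and> nrm X (x n) \<le> 1) \<and>
         limitin (norm_topology (proj_sym_tensor N X))
           (\<lambda>n. to_completion (sym_tensors N X) (power_comb N X n c x)) z sequentially \<and>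
         (\<lambda>n. norm (c n)) sums nrm (proj_sym_tensor N X) z}"

definition norm_attaining_dense ::
    "nat \<Rightarrow> ('k::real_normed_field, 'a) normed_space \<Rightarrow> bool"
  where "norm_attaining_dense N X \<longleftrightarrow>
    norm_topology (proj_sym_tensor N X) closure_of norm_attaining N X
      = carrier (proj_sym_tensor N X)"

end

theory Submission
  imports Defs
begin

text \<open>
  Given finitely many points of \<open>X\<close>, close them off to a countable set \<open>D\<close> under addition, under
  scalars from a countable dense set \<open>Q\<close>, and under adjoining the unit vectors of nearly optimal
  representations in \<open>X\<close> of all \<open>Q\<close>-combinations of powers of elements of \<open>D\<close>.  The closure \<open>Y\<close> of \<open>D\<close>
  is separable, and the map of symmetric tensor products induced by \<open>Y \<subseteq> X\<close> is isometric: this holds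
  on the \<open>Q\<close>-combinations by construction, and these are dense because \<open>z \<mapsto> z\<^sup>N\<close> is continuous.
  Hence norm attaining elements over \<open>Y\<close> remain norm attaining over \<open>X\<close>, and every algebraic
  tensor over \<open>X\<close> lives over such a \<open>Y\<close>.

  Since tensors are functionals on all multilinear forms, both the definiteness of the norm and the
  injectivity of the induced map need forms to be extended from a subspace.  It is enough to
  preserve the values at finitely many points, which a bounded finite rank projection from the
  Hahn-Banach theorem does.
\<close>

text \<open>For an arbitrary subspace \<open>Y\<close> the induced map merely does not increase the
  norm: a tensor over \<open>Y\<close> can have cheaper representations by unit vectors of
  \<open>X\<close> outside \<open>Y\<close>. Adjoining such vectors creates new tensors, which again
  may have cheaper representations outside; serving only countably many tensors in each round lets
  this process end after countably many rounds with a set that is still countable. A norm attaining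
  sequence is carried over literally, with the same scalars and vectors. What could fail over
  \<open>X\<close> is that the norm of the image drops below the sum of the absolute values of the
  scalars; the isometry excludes exactly this. \<open>Y\<close> is the record \<open>X\<close> with
  a smaller carrier. Its points therefore have the same type, and the hypothesis applies to it. Real
  and complex scalars are distinguished only in finding bounded functionals that separate points.
  The rest is done over a general normed field with this separation property, which also passes to
  subspaces.\<close>

lemma scalars_simps [simp]:
  "carrier scalars = UNIV" "x \<otimes>\<^bsub>scalars\<^esub> y = x * y" "\<one>\<^bsub>scalars\<^esub> = 1"
  "\<zero>\<^bsub>scalars\<^esub> = 0" "x \<oplus>\<^bsub>scalars\<^esub> y = x + y"
  by (auto simp: scalars_def)

text \<open>Inverses are supplied by the scalar \<open>- 1\<close>, and
  \<open>nrm X \<zero> = 0\<close> by homogeneity with the scalar 0. What remains can be checked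
  directly for completions, subspaces and tensors.\<close>

lemma normed_spaceI:
  fixes X :: "('k::real_normed_field, 'a) normed_space" (structure)
  assumes "\<And>x y. x \<in> carrier X \<Longrightarrow> y \<in> carrier X \<Longrightarrow> x \<oplus> y \<in> carrier X"
    and "\<zero> \<in> carrier X"
    and "\<And>c x. x \<in> carrier X \<Longrightarrow> c \<odot> x \<in> carrier X"
    and "\<And>x y z. x \<in> carrier X \<Longrightarrow> y \<in> carrier X \<Longrightarrow> z \<in> carrier X \<Longrightarrow>
      (x \<oplus> y) \<oplus> z = x \<oplus> (y \<oplus> z)"
    and "\<And>x y. x \<in> carrier X \<Longrightarrow> y \<in> carrier X \<Longrightarrow> x \<oplus> y = y \<oplus> x"
    and "\<And>x. x \<in> carrier X \<Longrightarrow> \<zero> \<oplus> x = x"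
    and "\<And>x. x \<in> carrier X \<Longrightarrow> 0 \<odot> x = \<zero>"
    and "\<And>x. x \<in> carrier X \<Longrightarrow> 1 \<odot> x = x"
    and "\<And>a b x. x \<in> carrier X \<Longrightarrow> (a + b) \<odot> x = a \<odot> x \<oplus> b \<odot> x"
    and "\<And>a x y. x \<in> carrier X \<Longrightarrow> y \<in> carrier X \<Longrightarrow> a \<odot> (x \<oplus> y) = a \<odot> x \<oplus> a \<odot> y"
    and "\<And>a b x. x \<in> carrier X \<Longrightarrow> (a * b) \<odot> x = a \<odot> (b \<odot> x)"
    and "\<And>x. x \<in> carrier X \<Longrightarrow> nrm X x = 0 \<Longrightarrow> x = \<zero>"
    and "\<And>c x. x \<in> carrier X \<Longrightarrow> nrm X (c \<odot> x) = norm c * nrm X x"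
    and "\<And>x y. x \<in> carrier X \<Longrightarrow> y \<in> carrier X \<Longrightarrow> nrm X (x \<oplus> y) \<le> nrm X x + nrm X y"
  shows "normed_space X"
proof -
  have "Module.module scalars X"
  proof (rule moduleI)
    show "abelian_group X"
    proof (rule abelian_groupI)
      fix x assume x: "x \<in> carrier X"
      have "(- 1) \<odot> x \<oplus> x = (- 1 + 1) \<odot> x" using assms(8,9) x by metis
      then show "\<exists>y\<in>carrier X. y \<oplus> x = \<zero>" using assms(3,7) x by (metis add.left_inverse)
    qed (use assms in auto)
  qed (use assms cring_scalars in auto)
  moreover have "nrm X \<zero> = 0"
    using assms(13)[of "\<zero>" 0] assms(2,7) by simp
  ultimately show ?thesis
    unfolding normed_space_def normed_space_axioms_def using assms(12-14) by auto
qed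

section \<open>Arithmetic and distances in a normed space\<close>

context normed_space
begin

lemma smult_in_carrier [simp]: "x \<in> carrier X \<Longrightarrow> c \<odot> x \<in> carrier X"
  using smult_closed[of c x] by simp

lemma smult_add_left: "x \<in> carrier X \<Longrightarrow> (a + b) \<odot> x = a \<odot> x \<oplus> b \<odot> x"
  using smult_l_distr[of a b x] by simp

lemma smult_add_right: "x \<in> carrier X \<Longrightarrow> y \<in> carrier X \<Longrightarrow> a \<odot> (x \<oplus> y) = a \<odot> x \<oplus> a \<odot> y"
  using smult_r_distr[of a x y] by simp

lemma smult_smult: "x \<in> carrier X \<Longrightarrow> a \<odot> (b \<odot> x) = (a * b) \<odot> x"
  using smult_assoc1[of a b x] by simp

lemma one_smult [simp]: "x \<in> carrier X \<Longrightarrow> 1 \<odot> x = x"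
  using smult_one[of x] by simp

lemma zero_smult [simp]: "x \<in> carrier X \<Longrightarrow> 0 \<odot> x = \<zero>"
  using smult_l_null[of x] by simp

lemma smult_zero [simp]: "c \<odot> \<zero> = \<zero>"
  using smult_r_null[of c] by simp

lemma a_inv_eq_smult: "x \<in> carrier X \<Longrightarrow> \<ominus> x = (- 1) \<odot> x"
  by (rule M.minus_equality) (use smult_add_left[of x "-1" 1] in auto)

text \<open>Negation is specified only as an inverse in the additive group, while scaling by
  \<open>- 1\<close> is explicit in completions and tensor spaces. Distances are therefore computed
  in this form throughout.\<close>

lemma ndist_eq: "x \<in> carrier X \<Longrightarrow> y \<in> carrier X \<Longrightarrow> ndist X x y = nrm X (x \<oplus> (- 1) \<odot> y)"
  by (simp add: ndist_def M.minus_eq a_inv_eq_smult)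

lemma add_minus_cancel: "x \<in> carrier X \<Longrightarrow> y \<in> carrier X \<Longrightarrow> x \<oplus> (y \<oplus> (- 1) \<odot> x) = y"
  using M.a_lcomm[of x y "\<ominus> x"] by (simp add: M.r_neg flip: a_inv_eq_smult)

lemma self_minus [simp]: "x \<in> carrier X \<Longrightarrow> x \<oplus> (- 1) \<odot> x = \<zero>"
  using M.r_neg[of x] by (simp add: a_inv_eq_smult)

lemma nrm_zero [simp]: "nrm X \<zero> = 0"
  by (simp add: nrm_eq_zero_iff)

lemma ndist_zero: "x \<in> carrier X \<Longrightarrow> ndist X x \<zero> = nrm X x"
  by (simp add: ndist_eq)

sublocale metric: Metric_space "carrier X" "ndist X"
  by (rule Metric_space_ndist)

lemma ndist_smult: "x \<in> carrier X \<Longrightarrow> y \<in> carrier X \<Longrightarrow> ndist X (c \<odot> x) (c \<odot> y) = norm c * ndist X x y"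
  by (simp add: ndist_eq smult_smult smult_add_right flip: nrm_smult)

lemma ndist_add:
  assumes "x \<in> carrier X" "y \<in> carrier X" "x' \<in> carrier X" "y' \<in> carrier X"
  shows "ndist X (x \<oplus> y) (x' \<oplus> y') \<le> ndist X x x' + ndist X y y'"
proof -
  have "x \<oplus> y \<oplus> (- 1) \<odot> (x' \<oplus> y') = (x \<oplus> (- 1) \<odot> x') \<oplus> (y \<oplus> (- 1) \<odot> y')"
    using assms by (simp add: smult_add_right M.a_ac)
  then show ?thesis using assms by (simp add: ndist_eq nrm_triangle)
qed

lemma nrm_diff_le_ndist:
  assumes "x \<in> carrier X" "y \<in> carrier X"
  shows "\<bar>nrm X x - nrm X y\<bar> \<le> ndist X x y"
  using metric.triangle[of x y "\<zero>"] metric.triangle[of y x "\<zero>"] metric.commute[of x y] assms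
  by (simp add: ndist_zero)

lemma limitin_iff_ndist:
  "limitin (norm_topology X) s l sequentially \<longleftrightarrow>
    l \<in> carrier X \<and> (\<forall>e>0. \<exists>M. \<forall>n\<ge>M. s n \<in> carrier X \<and> ndist X (s n) l < e)"
  by (simp add: metric.limit_metric_sequentially)

end

section \<open>The completion of a normed space\<close>

context normed_space
begin

abbreviation cls :: "(nat \<Rightarrow> 'a) \<Rightarrow> (nat \<Rightarrow> 'a) set"
  where "cls s \<equiv> null_rel X `` {s}"

lemma cauchy_seqs_iff:
  "s \<in> cauchy_seqs X \<longleftrightarrow> (\<forall>n. s n \<in> carrier X) \<and>
    (\<forall>e>0. \<exists>M. \<forall>m n. M \<le> m \<longrightarrow> M \<le> n \<longrightarrow> ndist X (s m) (s n) < e)"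
  by (auto simp: cauchy_seqs_def metric.MCauchy_def)

lemma cauchy_seqs_in_carrier: "s \<in> cauchy_seqs X \<Longrightarrow> s n \<in> carrier X"
  by (simp add: cauchy_seqs_iff)

lemma const_in_cauchy_seqs: "x \<in> carrier X \<Longrightarrow> (\<lambda>n. x) \<in> cauchy_seqs X"
  by (simp add: cauchy_seqs_iff)

lemma add_in_cauchy_seqs:
  assumes "s \<in> cauchy_seqs X" "t \<in> cauchy_seqs X"
  shows "(\<lambda>n. s n \<oplus> t n) \<in> cauchy_seqs X"
  unfolding cauchy_seqs_iff
proof (intro conjI allI impI)
  fix e :: real assume "e > 0"
  then obtain M1 M2 where M: "\<And>m n. M1 \<le> m \<Longrightarrow> M1 \<le> n \<Longrightarrow> ndist X (s m) (s n) < e / 2"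
      "\<And>m n. M2 \<le> m \<Longrightarrow> M2 \<le> n \<Longrightarrow> ndist X (t m) (t n) < e / 2"
    using assms unfolding cauchy_seqs_iff by (meson half_gt_zero)
  show "\<exists>M. \<forall>m n. M \<le> m \<longrightarrow> M \<le> n \<longrightarrow> ndist X (s m \<oplus> t m) (s n \<oplus> t n) < e"
  proof (intro exI[of _ "max M1 M2"] allI impI)
    fix m n assume mn: "max M1 M2 \<le> m" "max M1 M2 \<le> n"
    have "ndist X (s m \<oplus> t m) (s n \<oplus> t n) \<le> ndist X (s m) (s n) + ndist X (t m) (t n)"
      using assms by (intro ndist_add cauchy_seqs_in_carrier)
    then show "ndist X (s m \<oplus> t m) (s n \<oplus> t n) < e" using M(1)[of m n] M(2)[of m n] mn by simp
  qed
qed (use assms in \<open>simp add: cauchy_seqs_in_carrier\<close>)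

lemma smult_in_cauchy_seqs:
  assumes "s \<in> cauchy_seqs X"
  shows "(\<lambda>n. c \<odot> s n) \<in> cauchy_seqs X"
  unfolding cauchy_seqs_iff
proof (intro conjI allI impI)
  fix e :: real assume "e > 0"
  then have "e / (norm c + 1) > 0" by (simp add: add_nonneg_pos)
  then obtain M where M: "\<And>m n. M \<le> m \<Longrightarrow> M \<le> n \<Longrightarrow> ndist X (s m) (s n) < e / (norm c + 1)"
    using assms unfolding cauchy_seqs_iff by blast
  show "\<exists>M. \<forall>m n. M \<le> m \<longrightarrow> M \<le> n \<longrightarrow> ndist X (c \<odot> s m) (c \<odot> s n) < e"
  proof (intro exI[of _ M] allI impI)
    fix m n assume mn: "M \<le> m" "M \<le> n"
    have "ndist X (c \<odot> s m) (c \<odot> s n) = norm c * ndist X (s m) (s n)"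
      using assms by (intro ndist_smult cauchy_seqs_in_carrier)
    also have "\<dots> \<le> (norm c + 1) * ndist X (s m) (s n)" by (simp add: mult_right_mono)
    also have "\<dots> < e"
      using M[OF mn] by (simp add: pos_less_divide_eq add_nonneg_pos mult.commute)
    finally show "ndist X (c \<odot> s m) (c \<odot> s n) < e" .
  qed
qed (use assms in \<open>simp add: cauchy_seqs_in_carrier\<close>)

lemma equiv_null_rel: "equiv (cauchy_seqs X) (null_rel X)"
proof (intro equivI refl_onI symI transI)
  fix s t u assume st: "(s, t) \<in> null_rel X" and tu: "(t, u) \<in> null_rel X"
  then have C: "s \<in> cauchy_seqs X" "t \<in> cauchy_seqs X" "u \<in> cauchy_seqs X"
    by (auto simp: null_rel_def)
  have "(\<lambda>n. ndist X (s n) (t n) + ndist X (t n) (u n)) \<longlonglongrightarrow> 0 + 0"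
    using st tu by (intro tendsto_add) (auto simp: null_rel_def)
  then have "(\<lambda>n. ndist X (s n) (u n)) \<longlonglongrightarrow> 0"
    by (intro tendsto_sandwich[of "\<lambda>_. 0" "\<lambda>n. ndist X (s n) (u n)"])
      (use C in \<open>auto intro!: always_eventually metric.triangle cauchy_seqs_in_carrier\<close>)
  then show "(s, u) \<in> null_rel X" using C by (auto simp: null_rel_def)
qed (auto simp: null_rel_def metric.commute cauchy_seqs_in_carrier)

lemma null_rel_add:
  assumes "(s, s') \<in> null_rel X" "(t, t') \<in> null_rel X"
  shows "(\<lambda>n. s n \<oplus> t n, \<lambda>n. s' n \<oplus> t' n) \<in> null_rel X"
proof -
  have C: "s \<in> cauchy_seqs X" "s' \<in> cauchy_seqs X" "t \<in> cauchy_seqs X" "t' \<in> cauchy_seqs X"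
    using assms by (auto simp: null_rel_def)
  have "(\<lambda>n. ndist X (s n) (s' n) + ndist X (t n) (t' n)) \<longlonglongrightarrow> 0 + 0"
    using assms by (intro tendsto_add) (auto simp: null_rel_def)
  then have "(\<lambda>n. ndist X (s n \<oplus> t n) (s' n \<oplus> t' n)) \<longlonglongrightarrow> 0"
    by (intro tendsto_sandwich[of "\<lambda>_. 0" "\<lambda>n. ndist X (s n \<oplus> t n) (s' n \<oplus> t' n)"])
      (use C in \<open>auto intro!: always_eventually ndist_add cauchy_seqs_in_carrier\<close>)
  then show ?thesis using C by (auto simp: null_rel_def add_in_cauchy_seqs)
qed

lemma null_rel_smult:
  assumes "(s, s') \<in> null_rel X"
  shows "(\<lambda>n. c \<odot> s n, \<lambda>n. c \<odot> s' n) \<in> null_rel X"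
proof -
  have C: "s \<in> cauchy_seqs X" "s' \<in> cauchy_seqs X" using assms by (auto simp: null_rel_def)
  have "(\<lambda>n. norm c * ndist X (s n) (s' n)) \<longlonglongrightarrow> norm c * 0"
    using assms by (intro tendsto_mult tendsto_const) (auto simp: null_rel_def)
  then show ?thesis using C
    by (auto simp: null_rel_def smult_in_cauchy_seqs ndist_smult cauchy_seqs_in_carrier)
qed

lemma cls_eq_iff:
  "s \<in> cauchy_seqs X \<Longrightarrow> t \<in> cauchy_seqs X \<Longrightarrow> cls s = cls t \<longleftrightarrow> (s, t) \<in> null_rel X"
  using eq_equiv_class_iff[OF equiv_null_rel] .

lemma carrier_completion: "carrier (completion X) = cls ` cauchy_seqs X"
  by (auto simp: completion_def quotient_def)

lemma zero_completion: "\<zero>\<^bsub>completion X\<^esub> = cls (\<lambda>n. \<zero>)"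
  by (simp add: completion_def)

lemma add_completion:
  assumes "s \<in> cauchy_seqs X" "t \<in> cauchy_seqs X"
  shows "cls s \<oplus>\<^bsub>completion X\<^esub> cls t = cls (\<lambda>n. s n \<oplus> t n)"
proof -
  have "congruent2 (null_rel X) (null_rel X) (\<lambda>s t. cls (\<lambda>n. s n \<oplus> t n))"
    by (auto intro!: congruent2I' equiv_class_eq[OF equiv_null_rel] null_rel_add)
  then show ?thesis
    using UN_equiv_class2[OF equiv_null_rel equiv_null_rel _ assms] by (simp add: completion_def)
qed

lemma smult_completion:
  assumes "s \<in> cauchy_seqs X"
  shows "c \<odot>\<^bsub>completion X\<^esub> cls s = cls (\<lambda>n. c \<odot> s n)"
proof -
  have "congruent (null_rel X) (\<lambda>s. cls (\<lambda>n. c \<odot> s n))"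
    by (auto intro!: congruentI equiv_class_eq[OF equiv_null_rel] null_rel_smult)
  then show ?thesis
    using UN_equiv_class[OF equiv_null_rel _ assms] by (simp add: completion_def)
qed

text \<open>By the reverse triangle inequality the norms along a Cauchy sequence are Cauchy, and
  equivalent sequences have the same limit of norms. Since a class contains its representative, the
  \<open>THE\<close> in the definition of the norm has exactly one witness.\<close>

lemma nrm_completion:
  assumes "s \<in> cauchy_seqs X"
  shows "(\<lambda>n. nrm X (s n)) \<longlonglongrightarrow> nrm (completion X) (cls s)"
proof -
  have "Cauchy (\<lambda>n. nrm X (s n))"
  proof (rule metric_CauchyI)
    fix e :: real assume "e > 0"
    then obtain M where M: "\<And>m n. M \<le> m \<Longrightarrow> M \<le> n \<Longrightarrow> ndist X (s m) (s n) < e"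
      using assms unfolding cauchy_seqs_iff by blast
    have "dist (nrm X (s m)) (nrm X (s n)) \<le> ndist X (s m) (s n)" for m n
      using assms by (simp add: dist_real_def nrm_diff_le_ndist cauchy_seqs_in_carrier)
    then show "\<exists>M. \<forall>m\<ge>M. \<forall>n\<ge>M. dist (nrm X (s m)) (nrm X (s n)) < e"
      using M le_less_trans by blast
  qed
  then obtain r where r: "(\<lambda>n. nrm X (s n)) \<longlonglongrightarrow> r"
    using Cauchy_convergent_iff convergent_def by blast
  have "(\<lambda>n. nrm X (t n)) \<longlonglongrightarrow> r" if "t \<in> cls s" for t
  proof -
    have st: "t \<in> cauchy_seqs X" "(\<lambda>n. ndist X (s n) (t n)) \<longlonglongrightarrow> 0"
      using that by (auto simp: null_rel_def)
    have "(\<lambda>n. nrm X (t n) - nrm X (s n)) \<longlonglongrightarrow> 0"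
    proof (rule Lim_null_comparison[OF _ st(2)], rule always_eventually, rule allI)
      fix n show "norm (nrm X (t n) - nrm X (s n)) \<le> ndist X (s n) (t n)"
        using nrm_diff_le_ndist[of "s n" "t n"] assms st(1) by (simp add: cauchy_seqs_in_carrier)
    qed
    from tendsto_add[OF this r] show ?thesis by simp
  qed
  moreover have "s \<in> cls s" using equiv_class_self[OF equiv_null_rel assms] .
  ultimately have "(THE r. \<forall>t\<in>cls s. (\<lambda>n. nrm X (t n)) \<longlonglongrightarrow> r) = r"
    by (intro the_equality) (auto intro: LIMSEQ_unique)
  with r show ?thesis by (simp add: completion_def)
qed

text \<open>The algebraic laws hold termwise on representatives, and the triangle inequality and
  homogeneity pass to limits. Definiteness is where the quotient matters: norm 0 means that a
  representative is a null sequence.\<close>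

lemma normed_space_completion: "normed_space (completion X)"
proof (rule normed_spaceI, unfold carrier_completion)
  fix S T U a b
  assume "S \<in> cls ` cauchy_seqs X" "T \<in> cls ` cauchy_seqs X" "U \<in> cls ` cauchy_seqs X"
  then show "(S \<oplus>\<^bsub>completion X\<^esub> T) \<oplus>\<^bsub>completion X\<^esub> U = S \<oplus>\<^bsub>completion X\<^esub> (T \<oplus>\<^bsub>completion X\<^esub> U)"
    by (auto simp: add_completion add_in_cauchy_seqs cauchy_seqs_in_carrier M.a_assoc)
next
  fix S T a b assume "S \<in> cls ` cauchy_seqs X" "T \<in> cls ` cauchy_seqs X"
  then obtain s t where st: "s \<in> cauchy_seqs X" "S = cls s" "t \<in> cauchy_seqs X" "T = cls t"
    by auto
  show "S \<oplus>\<^bsub>completion X\<^esub> T \<in> cls ` cauchy_seqs X"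
    using st by (simp add: add_completion add_in_cauchy_seqs)
  show "S \<oplus>\<^bsub>completion X\<^esub> T = T \<oplus>\<^bsub>completion X\<^esub> S"
    using st by (simp add: add_completion cauchy_seqs_in_carrier M.a_comm)
  show "a \<odot>\<^bsub>completion X\<^esub> (S \<oplus>\<^bsub>completion X\<^esub> T) =
      a \<odot>\<^bsub>completion X\<^esub> S \<oplus>\<^bsub>completion X\<^esub> a \<odot>\<^bsub>completion X\<^esub> T"
    using st by (simp add: add_completion smult_completion add_in_cauchy_seqs smult_in_cauchy_seqs
        cauchy_seqs_in_carrier smult_add_right)
  show "nrm (completion X) (S \<oplus>\<^bsub>completion X\<^esub> T) \<le> nrm (completion X) S + nrm (completion X) T"
    unfolding st add_completion[OF st(1,3)]
    by (rule LIMSEQ_le[OF nrm_completion tendsto_add[OF nrm_completion nrm_completion]])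
      (use st in \<open>auto intro: add_in_cauchy_seqs nrm_triangle cauchy_seqs_in_carrier\<close>)
next
  fix S a b assume "S \<in> cls ` cauchy_seqs X"
  then obtain s where s: "s \<in> cauchy_seqs X" "S = cls s" by auto
  note [simp] = cauchy_seqs_in_carrier[OF s(1)]
  have Z: "(\<lambda>n. \<zero>) \<in> cauchy_seqs X" by (simp add: const_in_cauchy_seqs)
  show "a \<odot>\<^bsub>completion X\<^esub> S \<in> cls ` cauchy_seqs X"
    using s by (simp add: smult_completion smult_in_cauchy_seqs)
  show "\<zero>\<^bsub>completion X\<^esub> \<oplus>\<^bsub>completion X\<^esub> S = S"
    using s Z by (simp add: zero_completion add_completion)
  show "0 \<odot>\<^bsub>completion X\<^esub> S = \<zero>\<^bsub>completion X\<^esub>"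
    using s by (simp add: zero_completion smult_completion)
  show "1 \<odot>\<^bsub>completion X\<^esub> S = S"
    using s by (simp add: smult_completion)
  show "(a + b) \<odot>\<^bsub>completion X\<^esub> S = a \<odot>\<^bsub>completion X\<^esub> S \<oplus>\<^bsub>completion X\<^esub> b \<odot>\<^bsub>completion X\<^esub> S"
    using s by (simp add: add_completion smult_completion smult_in_cauchy_seqs smult_add_left)
  show "(a * b) \<odot>\<^bsub>completion X\<^esub> S = a \<odot>\<^bsub>completion X\<^esub> (b \<odot>\<^bsub>completion X\<^esub> S)"
    using s by (simp add: smult_completion smult_in_cauchy_seqs smult_smult)
  show "S = \<zero>\<^bsub>completion X\<^esub>" if "nrm (completion X) S = 0"
  proof -
    have "(\<lambda>n. ndist X (s n) \<zero>) \<longlonglongrightarrow> 0"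
      using nrm_completion[OF s(1)] that s by (simp add: ndist_zero)
    then show ?thesis
      unfolding s(2) zero_completion cls_eq_iff[OF s(1) Z] using s(1) Z by (simp add: null_rel_def)
  qed
  have "(\<lambda>n. nrm X (a \<odot> s n)) \<longlonglongrightarrow> norm a * nrm (completion X) S"
    using tendsto_mult[OF tendsto_const nrm_completion[OF s(1)], of "norm a"] s(2)
    by (simp add: nrm_smult)
  then show "nrm (completion X) (a \<odot>\<^bsub>completion X\<^esub> S) = norm a * nrm (completion X) S"
    using nrm_completion[OF smult_in_cauchy_seqs[OF s(1)]] LIMSEQ_unique s
    by (metis smult_completion)
qed (auto simp: zero_completion const_in_cauchy_seqs)

lemma ndist_completion:
  assumes "s \<in> cauchy_seqs X" "t \<in> cauchy_seqs X"
  shows "(\<lambda>n. ndist X (s n) (t n)) \<longlonglongrightarrow> ndist (completion X) (cls s) (cls t)"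
proof -
  interpret C: normed_space "completion X" by (rule normed_space_completion)
  have "(\<lambda>n. nrm X (s n \<oplus> (- 1) \<odot> t n)) \<longlonglongrightarrow>
      nrm (completion X) (cls (\<lambda>n. s n \<oplus> (- 1) \<odot> t n))"
    using assms by (intro nrm_completion add_in_cauchy_seqs smult_in_cauchy_seqs)
  then show ?thesis
    using assms by (simp add: ndist_eq C.ndist_eq carrier_completion cauchy_seqs_in_carrier
        smult_completion add_completion smult_in_cauchy_seqs)
qed

lemma to_completion_in_carrier: "x \<in> carrier X \<Longrightarrow> to_completion X x \<in> carrier (completion X)"
  by (simp add: to_completion_def carrier_completion const_in_cauchy_seqs)

lemma to_completion_dense:
  assumes "z \<in> carrier (completion X)" "e > 0"
  obtains x where "x \<in> carrier X" "ndist (completion X) (to_completion X x) z < e"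
proof -
  obtain s where s: "s \<in> cauchy_seqs X" "z = cls s" using assms by (auto simp: carrier_completion)
  obtain M where M: "\<And>m n. M \<le> m \<Longrightarrow> M \<le> n \<Longrightarrow> ndist X (s m) (s n) < e / 2"
    using s(1) assms(2) unfolding cauchy_seqs_iff by (meson half_gt_zero)
  have sM: "s M \<in> carrier X" using s(1) by (rule cauchy_seqs_in_carrier)
  have "(\<lambda>n. ndist X (s M) (s n)) \<longlonglongrightarrow> ndist (completion X) (to_completion X (s M)) z"
    unfolding to_completion_def s(2)
    by (rule ndist_completion[OF const_in_cauchy_seqs[OF sM] s(1)])
  \<comment> \<open>Passing to the limit keeps only \<le>, hence the tolerance
    \<open>e / 2\<close>.\<close>
  then have "ndist (completion X) (to_completion X (s M)) z \<le> e / 2"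
    by (rule LIMSEQ_le_const2) (use M in \<open>auto intro: less_imp_le\<close>)
  then show ?thesis using that[OF sM] assms(2) by simp
qed

end

text \<open>\<open>J\<close> composes a representative with \<open>j\<close>; preservation of
  distances makes this respect Cauchy sequences and their equivalence. Norm attainment is a matter
  of norms, limits and embedded points, so these are the properties recorded for
  \<open>J\<close>.\<close>

lemma completion_isometry:
  fixes X :: "('k::real_normed_field, 'a) normed_space" and X' :: "('k, 'b) normed_space"
  assumes "normed_space X" "normed_space X'"
    and j: "\<And>x. x \<in> carrier X \<Longrightarrow> j x \<in> carrier X'"
      "\<And>x y. x \<in> carrier X \<Longrightarrow> y \<in> carrier X \<Longrightarrow> ndist X' (j x) (j y) = ndist X x y"
      "\<And>x. x \<in> carrier X \<Longrightarrow> nrm X' (j x) = nrm X x"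
  obtains J where
    "\<And>z. z \<in> carrier (completion X) \<Longrightarrow> J z \<in> carrier (completion X')"
    "\<And>z. z \<in> carrier (completion X) \<Longrightarrow> nrm (completion X') (J z) = nrm (completion X) z"
    "\<And>z w. z \<in> carrier (completion X) \<Longrightarrow> w \<in> carrier (completion X) \<Longrightarrow>
      ndist (completion X') (J z) (J w) = ndist (completion X) z w"
    "\<And>x. x \<in> carrier X \<Longrightarrow> J (to_completion X x) = to_completion X' (j x)"
proof -
  interpret X: normed_space X by fact
  interpret X': normed_space X' by fact
  define J where "J = (\<lambda>S. \<Union>s\<in>S. X'.cls (j \<circ> s))"
  have C: "j \<circ> s \<in> cauchy_seqs X'" if "s \<in> cauchy_seqs X" for s
    using that j(1,2) unfolding X.cauchy_seqs_iff X'.cauchy_seqs_iff by simp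
  have rel: "(j \<circ> s, j \<circ> t) \<in> null_rel X'" if "(s, t) \<in> null_rel X" for s t
    using that C j(2) X.cauchy_seqs_in_carrier by (auto simp: null_rel_def)
  have "congruent (null_rel X) (\<lambda>s. X'.cls (j \<circ> s))"
    using rel by (auto intro!: congruentI equiv_class_eq[OF X'.equiv_null_rel])
  then have J: "J (X.cls s) = X'.cls (j \<circ> s)" if "s \<in> cauchy_seqs X" for s
    using UN_equiv_class[OF X.equiv_null_rel _ that] by (simp add: J_def)
  show ?thesis
  proof
    fix z assume "z \<in> carrier (completion X)"
    then obtain s where s: "s \<in> cauchy_seqs X" "z = X.cls s" by (auto simp: X.carrier_completion)
    show "J z \<in> carrier (completion X')" using s C by (simp add: J X'.carrier_completion)
    have "(\<lambda>n. nrm X (s n)) \<longlonglongrightarrow> nrm (completion X') (J z)"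
      using X'.nrm_completion[OF C[OF s(1)]] j(3) s X.cauchy_seqs_in_carrier by (simp add: J)
    with X.nrm_completion[OF s(1)] s(2)
    show "nrm (completion X') (J z) = nrm (completion X) z" by (auto intro: LIMSEQ_unique)
  next
    fix z w assume "z \<in> carrier (completion X)" "w \<in> carrier (completion X)"
    then obtain s t where s: "s \<in> cauchy_seqs X" "z = X.cls s" "t \<in> cauchy_seqs X" "w = X.cls t"
      by (auto simp: X.carrier_completion)
    have "(\<lambda>n. ndist X (s n) (t n)) \<longlonglongrightarrow> ndist (completion X') (J z) (J w)"
      using X'.ndist_completion[OF C[OF s(1)] C[OF s(3)]] j(2) s X.cauchy_seqs_in_carrier
      by (simp add: J)
    with X.ndist_completion[OF s(1,3)] s
    show "ndist (completion X') (J z) (J w) = ndist (completion X) z w"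
      by (auto intro: LIMSEQ_unique)
  next
    fix x assume "x \<in> carrier X"
    then show "J (to_completion X x) = to_completion X' (j x)"
      by (simp add: to_completion_def J X.const_in_cauchy_seqs o_def)
  qed
qed

section \<open>The Hahn-Banach theorem\<close>

definition bounded_functionals :: "('k::real_normed_field, 'a) normed_space \<Rightarrow> ('a \<Rightarrow> 'k) set"
  where "bounded_functionals X =
    {F. (\<forall>x\<in>carrier X. \<forall>y\<in>carrier X. F (x \<oplus>\<^bsub>X\<^esub> y) = F x + F y) \<and>
        (\<forall>c. \<forall>x\<in>carrier X. F (c \<odot>\<^bsub>X\<^esub> x) = c * F x) \<and>
        (\<exists>K. \<forall>x\<in>carrier X. norm (F x) \<le> K * nrm X x)}"

text \<open>Isolates the one property whose proof differs between real and complex scalars, so that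
  everything built on it is written once for a general field.\<close>

definition functionals_separate :: "('k::real_normed_field, 'a) normed_space \<Rightarrow> bool"
  where "functionals_separate X \<longleftrightarrow>
    (\<forall>x\<in>carrier X. x \<noteq> \<zero>\<^bsub>X\<^esub> \<longrightarrow> (\<exists>F\<in>bounded_functionals X. F x = 1))"

section \<open>Sublinear functionals and the real Hahn-Banach theorem\<close>

context normed_space
begin

text \<open>Homogeneity concerns nonnegative real scalars, so a complex space is treated as a real
  one. The value 0 off the carrier makes the pointwise order on the whole type agree with the order
  on the carrier, as Zorn's lemma requires an antisymmetric order.\<close>

definition sublinear :: "('a \<Rightarrow> real) \<Rightarrow> bool"
  where "sublinear q \<longleftrightarrow>
    (\<forall>x\<in>carrier X. \<forall>y\<in>carrier X. q (x \<oplus> y) \<le> q x + q y) \<and>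
    (\<forall>t\<ge>0. \<forall>x\<in>carrier X. q (of_real t \<odot> x) = t * q x) \<and>
    (\<forall>x. x \<notin> carrier X \<longrightarrow> q x = 0)"

lemma sublinear_add:
  "sublinear q \<Longrightarrow> x \<in> carrier X \<Longrightarrow> y \<in> carrier X \<Longrightarrow> q (x \<oplus> y) \<le> q x + q y"
  by (simp add: sublinear_def)

lemma sublinear_smult:
  "sublinear q \<Longrightarrow> 0 \<le> t \<Longrightarrow> x \<in> carrier X \<Longrightarrow> q (of_real t \<odot> x) = t * q x"
  by (simp add: sublinear_def)

lemma sublinear_zero: "sublinear q \<Longrightarrow> q \<zero> = 0"
  using sublinear_smult[of q 0 "\<zero>"] by simp

lemma sublinear_minus:
  assumes "sublinear q" "x \<in> carrier X"
  shows "- q ((- 1) \<odot> x) \<le> q x"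
  using sublinear_add[OF assms(1), of x "(- 1) \<odot> x"] assms by (simp add: sublinear_zero)

text \<open>The usual auxiliary functional for minimal sublinear functionals: it is sublinear, lies
  below \<open>q\<close>, and is pushed down at \<open>- r\<close> as far as oddness at
  \<open>r\<close> demands.\<close>

definition directional :: "('a \<Rightarrow> real) \<Rightarrow> 'a \<Rightarrow> 'a \<Rightarrow> real"
  where "directional q r x =
    (if x \<in> carrier X then INF t\<in>{0..}. q (x \<oplus> of_real t \<odot> r) - t * q r else 0)"

context
  fixes q :: "'a \<Rightarrow> real" and r
  assumes q: "sublinear q" and r: "r \<in> carrier X"
begin

lemma directional_bdd:
  assumes "x \<in> carrier X"
  shows "bdd_below ((\<lambda>t. q (x \<oplus> of_real t \<odot> r) - t * q r) ` {0..})"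
proof (rule bdd_belowI2)
  fix t :: real assume "t \<in> {0..}"
  then have "t * q r = q (of_real t \<odot> r)" using sublinear_smult[OF q _ r] by simp
  also have "of_real t \<odot> r = (- 1) \<odot> x \<oplus> (x \<oplus> of_real t \<odot> r)"
    using assms r by (simp add: M.r_neg1 flip: a_inv_eq_smult)
  also have "q \<dots> \<le> q ((- 1) \<odot> x) + q (x \<oplus> of_real t \<odot> r)"
    using assms r by (intro sublinear_add[OF q]) auto
  finally show "- q ((- 1) \<odot> x) \<le> q (x \<oplus> of_real t \<odot> r) - t * q r" by simp
qed

lemma directional_le:
  "x \<in> carrier X \<Longrightarrow> 0 \<le> t \<Longrightarrow> directional q r x \<le> q (x \<oplus> of_real t \<odot> r) - t * q r"
  unfolding directional_def by (auto intro: cINF_lower[OF directional_bdd])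

lemma directional_greatest:
  "x \<in> carrier X \<Longrightarrow> (\<And>t. 0 \<le> t \<Longrightarrow> c \<le> q (x \<oplus> of_real t \<odot> r) - t * q r) \<Longrightarrow> c \<le> directional q r x"
  unfolding directional_def by (auto intro: cINF_greatest)

lemma directional_le_self: "directional q r x \<le> q x"
proof (cases "x \<in> carrier X")
  case True
  then show ?thesis using directional_le[of x 0] r by simp
qed (use q in \<open>simp add: directional_def sublinear_def\<close>)

text \<open>The choice \<open>t = 1\<close> in the infimum makes the argument of \<open>q\<close>
  zero.\<close>

lemma directional_minus: "directional q r ((- 1) \<odot> r) \<le> - q r"
  using directional_le[of "(- 1) \<odot> r" 1] r sublinear_zero[OF q]
  by (simp add: M.l_neg flip: a_inv_eq_smult)

text \<open>For subadditivity, parameters \<open>t\<close> for \<open>x\<close> and \<open>s\<close>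
  for \<open>y\<close> combine to the parameter \<open>t + s\<close> for the sum; the two infima are
  then taken one after the other.\<close>

lemma sublinear_directional: "sublinear (directional q r)"
  unfolding sublinear_def
proof (intro conjI ballI allI impI)
  fix x y assume xy: "x \<in> carrier X" "y \<in> carrier X"
  have *: "directional q r (x \<oplus> y) \<le>
      (q (x \<oplus> of_real t \<odot> r) - t * q r) + (q (y \<oplus> of_real s \<odot> r) - s * q r)"
    if "0 \<le> t" "0 \<le> s" for t s
  proof -
    have "directional q r (x \<oplus> y) \<le> q ((x \<oplus> y) \<oplus> of_real (t + s) \<odot> r) - (t + s) * q r"
      using that xy by (intro directional_le) auto
    also have "(x \<oplus> y) \<oplus> of_real (t + s) \<odot> r = (x \<oplus> of_real t \<odot> r) \<oplus> (y \<oplus> of_real s \<odot> r)"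
      using xy r by (simp add: smult_add_left M.a_ac)
    also have "q \<dots> \<le> q (x \<oplus> of_real t \<odot> r) + q (y \<oplus> of_real s \<odot> r)"
      using xy r by (intro sublinear_add[OF q]) auto
    finally show ?thesis by (simp add: algebra_simps)
  qed
  have "directional q r (x \<oplus> y) - (q (x \<oplus> of_real t \<odot> r) - t * q r) \<le> directional q r y"
    if "0 \<le> t" for t
    using *[OF that] by (intro directional_greatest[OF xy(2)]) (simp add: algebra_simps)
  then have "directional q r (x \<oplus> y) - directional q r y \<le> directional q r x"
    by (intro directional_greatest[OF xy(1)]) (simp add: algebra_simps)
  then show "directional q r (x \<oplus> y) \<le> directional q r x + directional q r y" by simp
next
  fix t :: real and x assume t: "0 \<le> t" and x: "x \<in> carrier X"
  \<comment> \<open>Rescaling the parameter to \<open>c * s\<close> gives one inequality for every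
    positive \<open>c\<close>. The same inequality for \<open>1 / t\<close> at the point
    \<open>of_real t \<odot> x\<close> gives the reverse one.\<close>
  have le: "directional q r (of_real c \<odot> y) \<le> c * directional q r y"
    if "0 < c" "y \<in> carrier X" for c y
  proof -
    have "directional q r (of_real c \<odot> y) / c \<le> directional q r y"
    proof (rule directional_greatest[OF that(2)])
      fix s :: real assume s: "0 \<le> s"
      have "directional q r (of_real c \<odot> y) \<le>
          q (of_real c \<odot> y \<oplus> of_real (c * s) \<odot> r) - (c * s) * q r"
        using s that by (intro directional_le) auto
      also have "of_real c \<odot> y \<oplus> of_real (c * s) \<odot> r = of_real c \<odot> (y \<oplus> of_real s \<odot> r)"
        using that r by (simp add: smult_add_right smult_smult)
      also have "q \<dots> = c * q (y \<oplus> of_real s \<odot> r)"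
        using that r by (intro sublinear_smult[OF q]) auto
      finally have "directional q r (of_real c \<odot> y) \<le> c * (q (y \<oplus> of_real s \<odot> r) - s * q r)"
        by (simp add: algebra_simps)
      then show "directional q r (of_real c \<odot> y) / c \<le> q (y \<oplus> of_real s \<odot> r) - s * q r"
        using that by (simp add: field_simps)
    qed
    then show ?thesis using that by (simp add: field_simps)
  qed
  show "directional q r (of_real t \<odot> x) = t * directional q r x"
  proof (cases "t = 0")
    case True
    have "directional q r \<zero> \<le> 0" using directional_le_self[of "\<zero>"] sublinear_zero[OF q] by simp
    moreover have "0 \<le> directional q r \<zero>"
      using sublinear_smult[OF q _ r] r by (intro directional_greatest) auto
    ultimately show ?thesis using True x by simp
  next
    case False
    then have "0 < t" using t by simp
    have "directional q r (of_real (1 / t) \<odot> (of_real t \<odot> x)) \<le> 1 / t * directional q r (of_real t \<odot> x)"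
      using x \<open>0 < t\<close> by (intro le) auto
    then have "t * directional q r x \<le> directional q r (of_real t \<odot> x)"
      using x \<open>0 < t\<close> by (simp add: smult_smult field_simps flip: of_real_mult)
    then show ?thesis using le[OF \<open>0 < t\<close> x] by simp
  qed
qed (simp add: directional_def)

end

text \<open>Provides lower bounds of chains for Zorn's lemma. The chain condition enters in
  subadditivity: for two members, the smaller one serves both summands.\<close>

lemma sublinear_INF:
  assumes "Q \<noteq> {}" "\<And>q. q \<in> Q \<Longrightarrow> sublinear q" "\<And>q x. q \<in> Q \<Longrightarrow> q x \<le> p x"
    and chain: "\<And>q q'. q \<in> Q \<Longrightarrow> q' \<in> Q \<Longrightarrow> q \<le> q' \<or> q' \<le> q"
  defines "\<And>x. i x \<equiv> INF q\<in>Q. q x"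
  shows "sublinear i" "\<And>q. q \<in> Q \<Longrightarrow> i \<le> q"
proof -
  have bdd: "bdd_below ((\<lambda>q. q x) ` Q)" for x
  proof (rule bdd_belowI2)
    fix q assume q: "q \<in> Q"
    \<comment> \<open>On the carrier, \<open>q x\<close> is at least \<open>- q (- x)\<close> and
      hence at least \<open>- p (- x)\<close>; off the carrier \<open>q\<close> is 0, which accounts
      for the minimum with 0.\<close>
    show "min 0 (- p ((- 1) \<odot> x)) \<le> q x"
    proof (cases "x \<in> carrier X")
      case True
      then show ?thesis using sublinear_minus[OF assms(2)[OF q] True] assms(3)[OF q, of "(- 1) \<odot> x"]
        by linarith
    next
      case False
      then show ?thesis using assms(2)[OF q] by (simp add: sublinear_def)
    qed
  qed
  show le: "i \<le> q" if "q \<in> Q" for q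
    unfolding i_def using that by (auto intro!: le_funI cINF_lower bdd)
  show "sublinear i"
    unfolding sublinear_def
  proof (intro conjI ballI allI impI)
    fix x y assume xy: "x \<in> carrier X" "y \<in> carrier X"
    have *: "i (x \<oplus> y) \<le> q x + q' y" if qq: "q \<in> Q" "q' \<in> Q" for q q'
    proof -
      obtain m where m: "m \<in> Q" "m \<le> q" "m \<le> q'" using chain[OF qq] qq by blast
      have "i (x \<oplus> y) \<le> m (x \<oplus> y)" using le[OF m(1)] by (simp add: le_funD)
      also have "\<dots> \<le> m x + m y" using assms(2)[OF m(1)] xy by (simp add: sublinear_add)
      also have "\<dots> \<le> q x + q' y" using m by (intro add_mono) (auto simp: le_funD)
      finally show ?thesis .
    qed
    have "i (x \<oplus> y) - q x \<le> i y" if "q \<in> Q" for q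
      unfolding i_def[of y] using *[OF that] assms(1)
      by (intro cINF_greatest) (auto simp: algebra_simps)
    then have "i (x \<oplus> y) - i y \<le> i x"
      unfolding i_def[of x] using assms(1) by (intro cINF_greatest) (auto simp: algebra_simps)
    then show "i (x \<oplus> y) \<le> i x + i y" by simp
  next
    fix t :: real and x assume t: "0 \<le> t" and x: "x \<in> carrier X"
    have le: "i (of_real c \<odot> y) \<le> c * i y" if "0 < c" "y \<in> carrier X" for c y
    proof -
      have "i (of_real c \<odot> y) / c \<le> i y"
        unfolding i_def[of y]
      proof (rule cINF_greatest[OF assms(1)])
        fix q assume q: "q \<in> Q"
        then show "i (of_real c \<odot> y) / c \<le> q y"
          using le_funD[OF le[OF q], of "of_real c \<odot> y"] sublinear_smult[OF assms(2)[OF q], of c y] that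
          by (simp add: field_simps)
      qed
      then show ?thesis using that by (simp add: field_simps)
    qed
    show "i (of_real t \<odot> x) = t * i x"
    proof (cases "t = 0")
      case True
      have "i \<zero> = (INF q\<in>Q. 0)"
        unfolding i_def by (rule INF_cong) (auto simp: sublinear_zero assms(2))
      then show ?thesis using True x assms(1) by simp
    next
      case False
      then have "0 < t" using t by simp
      have "i (of_real (1 / t) \<odot> (of_real t \<odot> x)) \<le> 1 / t * i (of_real t \<odot> x)"
        using x \<open>0 < t\<close> by (intro le) auto
      then have "t * i x \<le> i (of_real t \<odot> x)"
        using x \<open>0 < t\<close> by (simp add: smult_smult field_simps flip: of_real_mult)
      then show ?thesis using le[OF \<open>0 < t\<close> x] by simp
    qed
  next
    fix x assume "x \<notin> carrier X"
    then have "i x = (INF q\<in>Q. 0)"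
      unfolding i_def by (intro INF_cong) (auto dest: assms(2) simp: sublinear_def)
    then show "i x = 0" using assms(1) by simp
  qed
qed

text \<open>
  A minimal sublinear functional \<open>m\<close> coincides with \<^term>\<open>directional m r\<close> for every \<open>r\<close>,
  which makes it odd and hence linear.
\<close>

lemma real_Hahn_Banach:
  assumes r: "r \<in> carrier X"
  obtains f :: "'a \<Rightarrow> real" where
    "\<And>x y. x \<in> carrier X \<Longrightarrow> y \<in> carrier X \<Longrightarrow> f (x \<oplus> y) = f x + f y"
    "\<And>t x. x \<in> carrier X \<Longrightarrow> f (of_real t \<odot> x) = t * f x"
    "\<And>x. x \<in> carrier X \<Longrightarrow> \<bar>f x\<bar> \<le> nrm X x"
    "f r = nrm X r"
proof -
  define p where "p x = (if x \<in> carrier X then nrm X x else 0)" for x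
  have p: "sublinear p" by (auto simp: sublinear_def p_def nrm_triangle nrm_smult)
  \<comment> \<open>Searching below \<open>directional p r\<close> instead of \<open>p\<close> fixes
    the value at \<open>r\<close>: every member is at most \<open>- p r\<close> at
    \<open>- r\<close>, and a linear one is then at least \<open>p r\<close> at
    \<open>r\<close>.\<close>
  define A where "A = {q. sublinear q \<and> q \<le> directional p r}"
  have "\<exists>m\<in>A. \<forall>a\<in>A. a \<le> m \<longrightarrow> a = m"
  proof (rule predicate_Zorn)
    show "partial_order_on A (relation_of (\<lambda>a b. b \<le> a) A)"
      by (auto simp: partial_order_on_def preorder_on_def refl_on_def trans_def antisym_def
          relation_of_def)
  next
    fix C assume C: "C \<in> Chains (relation_of (\<lambda>a b. b \<le> a) A)"
    show "\<exists>u\<in>A. \<forall>a\<in>C. u \<le> a"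
    proof (cases "C = {}")
      case True
      then show ?thesis using sublinear_directional[OF p r] by (auto simp: A_def)
    next
      case False
      have CA: "C \<subseteq> A" using C by (auto simp: Chains_def relation_of_def)
      have s: "sublinear q" "q x \<le> directional p r x" if "q \<in> C" for q x
        using that CA by (auto simp: A_def le_fun_def)
      have ch: "q \<le> q' \<or> q' \<le> q" if "q \<in> C" "q' \<in> C" for q q'
        using C that by (auto simp: Chains_def relation_of_def)
      have i: "sublinear (\<lambda>x. INF q\<in>C. q x)" "\<And>q. q \<in> C \<Longrightarrow> (\<lambda>x. INF q\<in>C. q x) \<le> q"
        by (rule sublinear_INF[where p = "directional p r"]; use False s ch in blast)+
      obtain q where "q \<in> C" using False by blast
      then have "(\<lambda>x. INF q\<in>C. q x) \<le> directional p r"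
        using i(2) s(2) by (meson le_funI order_trans)
      then show ?thesis using i by (auto simp: A_def)
    qed
  qed
  then obtain m where m: "m \<in> A" "\<And>a. a \<in> A \<Longrightarrow> a \<le> m \<Longrightarrow> a = m" by blast
  have ms: "sublinear m" using m by (simp add: A_def)
  have odd: "m ((- 1) \<odot> x) = - m x" if x: "x \<in> carrier X" for x
  proof -
    have "directional m x \<le> m" using directional_le_self[OF ms x] by (simp add: le_fun_def)
    moreover from this have "directional m x \<in> A"
      using m(1) sublinear_directional[OF ms x] by (auto simp: A_def)
    ultimately have "directional m x = m" using m(2) by blast
    then show ?thesis using directional_minus[OF ms x] sublinear_minus[OF ms x] by simp
  qed
  have mp: "m x \<le> p x" for x
    using m(1) directional_le_self[OF p r, of x] order_trans by (fastforce simp: A_def le_fun_def)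
  show ?thesis
  proof
    fix x y assume xy: "x \<in> carrier X" "y \<in> carrier X"
    have "m x = m ((x \<oplus> y) \<oplus> (- 1) \<odot> y)" using xy by (simp add: M.a_assoc)
    also have "\<dots> \<le> m (x \<oplus> y) + m ((- 1) \<odot> y)" using xy by (intro sublinear_add[OF ms]) auto
    finally show "m (x \<oplus> y) = m x + m y" using sublinear_add[OF ms xy] odd[OF xy(2)] by simp
  next
    fix t :: real and x assume x: "x \<in> carrier X"
    show "m (of_real t \<odot> x) = t * m x"
    proof (cases "0 \<le> t")
      case False
      have "m (of_real t \<odot> x) = m ((- 1) \<odot> (of_real (- t) \<odot> x))" using x by (simp add: smult_smult)
      also have "\<dots> = - m (of_real (- t) \<odot> x)" using x by (intro odd) simp
      also have "m (of_real (- t) \<odot> x) = - t * m x"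
        using False x by (intro sublinear_smult[OF ms]) auto
      finally show ?thesis by simp
    qed (use x sublinear_smult[OF ms] in auto)
  next
    fix x assume x: "x \<in> carrier X"
    then show "\<bar>m x\<bar> \<le> nrm X x"
      using mp[of x] mp[of "(- 1) \<odot> x"] odd[OF x] by (simp add: p_def nrm_smult)
  next
    have "m ((- 1) \<odot> r) \<le> directional p r ((- 1) \<odot> r)" using m(1) by (simp add: A_def le_fun_def)
    also have "\<dots> \<le> - p r" by (rule directional_minus[OF p r])
    finally show "m r = nrm X r" using odd[OF r] mp[of r] r by (simp add: p_def)
  qed
qed

end

section \<open>Bounded functionals that separate points\<close>

lemma functionals_separate_real:
  fixes X :: "(real, 'a) normed_space"
  assumes "normed_space X" shows "functionals_separate X"
  unfolding functionals_separate_def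
proof (intro ballI impI)
  interpret normed_space X by fact
  fix r assume r: "r \<in> carrier X" "r \<noteq> \<zero>\<^bsub>X\<^esub>"
  obtain f where f: "\<And>x y. x \<in> carrier X \<Longrightarrow> y \<in> carrier X \<Longrightarrow> f (x \<oplus>\<^bsub>X\<^esub> y) = f x + f y"
    "\<And>t x. x \<in> carrier X \<Longrightarrow> f (of_real t \<odot>\<^bsub>X\<^esub> x) = t * f x"
    "\<And>x. x \<in> carrier X \<Longrightarrow> \<bar>f x\<bar> \<le> nrm X x" "f r = nrm X r"
    by (rule real_Hahn_Banach[OF r(1)]) (blast intro: that)
  have pos: "nrm X r > 0" using r nrm_nonneg[of r] nrm_eq_zero_iff[of r] by simp
  have "(\<lambda>x. f x / nrm X r) \<in> bounded_functionals X"
    unfolding bounded_functionals_def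
    using f pos by (auto simp: add_divide_distrib intro!: exI[of _ "1 / nrm X r"] divide_right_mono)
  then show "\<exists>F\<in>bounded_functionals X. F r = 1" using f(4) pos by (intro bexI) auto
qed

text \<open>The complex linear functional with real part \<open>f\<close> is
  \<open>f x - \<i> f (\<i> x)\<close>. Only some bound is required, so the sum of the absolute
  values of real and imaginary part suffices and yields the constant 2.\<close>

lemma functionals_separate_complex:
  fixes X :: "(complex, 'a) normed_space"
  assumes "normed_space X" shows "functionals_separate X"
  unfolding functionals_separate_def
proof (intro ballI impI)
  interpret normed_space X by fact
  fix r assume r: "r \<in> carrier X" "r \<noteq> \<zero>\<^bsub>X\<^esub>"
  obtain f where f: "\<And>x y. x \<in> carrier X \<Longrightarrow> y \<in> carrier X \<Longrightarrow> f (x \<oplus>\<^bsub>X\<^esub> y) = f x + f y"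
    "\<And>t x. x \<in> carrier X \<Longrightarrow> f (of_real t \<odot>\<^bsub>X\<^esub> x) = t * f x"
    "\<And>x. x \<in> carrier X \<Longrightarrow> \<bar>f x\<bar> \<le> nrm X x" "f r = nrm X r"
    by (rule real_Hahn_Banach[OF r(1)]) (blast intro: that)
  define g where "g x = Complex (f x) (- f (\<i> \<odot>\<^bsub>X\<^esub> x))" for x
  have g_smult: "g (c \<odot>\<^bsub>X\<^esub> x) = c * g x" if x: "x \<in> carrier X" for c x
  proof -
    have "c \<odot>\<^bsub>X\<^esub> x = of_real (Re c) \<odot>\<^bsub>X\<^esub> x \<oplus>\<^bsub>X\<^esub> of_real (Im c) \<odot>\<^bsub>X\<^esub> (\<i> \<odot>\<^bsub>X\<^esub> x)"
      using complex_eq[of c] x by (simp add: smult_smult mult.commute flip: smult_add_left)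
    then have 1: "f (c \<odot>\<^bsub>X\<^esub> x) = Re c * f x + Im c * f (\<i> \<odot>\<^bsub>X\<^esub> x)"
      using f(1,2) x by simp
    have "\<i> * c = of_real (- Im c) + of_real (Re c) * \<i>"
      by (simp add: complex_eq_iff)
    then have "\<i> \<odot>\<^bsub>X\<^esub> (c \<odot>\<^bsub>X\<^esub> x) =
        of_real (- Im c) \<odot>\<^bsub>X\<^esub> x \<oplus>\<^bsub>X\<^esub> of_real (Re c) \<odot>\<^bsub>X\<^esub> (\<i> \<odot>\<^bsub>X\<^esub> x)"
      using x by (simp only: smult_smult smult_in_carrier flip: smult_add_left)
    then have 2: "f (\<i> \<odot>\<^bsub>X\<^esub> (c \<odot>\<^bsub>X\<^esub> x)) = - Im c * f x + Re c * f (\<i> \<odot>\<^bsub>X\<^esub> x)"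
      using f(1)[of "of_real (- Im c) \<odot>\<^bsub>X\<^esub> x" "of_real (Re c) \<odot>\<^bsub>X\<^esub> (\<i> \<odot>\<^bsub>X\<^esub> x)"]
        f(2)[of x "- Im c"] f(2)[of "\<i> \<odot>\<^bsub>X\<^esub> x" "Re c"] x by simp
    show ?thesis by (simp add: g_def 1 2 complex_eq_iff algebra_simps)
  qed
  have g_le: "norm (g x) \<le> 2 * nrm X x" if x: "x \<in> carrier X" for x
    using f(3)[OF x] f(3)[of "\<i> \<odot>\<^bsub>X\<^esub> x"] cmod_le[of "g x"] x
    by (simp add: g_def nrm_smult)
  have g_add: "g (x \<oplus>\<^bsub>X\<^esub> y) = g x + g y" if "x \<in> carrier X" "y \<in> carrier X" for x y
    using f(1)[of x y] f(1)[of "\<i> \<odot>\<^bsub>X\<^esub> x" "\<i> \<odot>\<^bsub>X\<^esub> y"] that by (simp add: g_def smult_add_right complex_eq_iff)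
  \<comment> \<open>The real part of \<open>g r\<close> is \<open>nrm X r\<close>, so division by
    \<open>g r\<close> normalizes the value at \<open>r\<close>.\<close>
  have nz: "g r \<noteq> 0"
    using r f(4) nrm_eq_zero_iff[of r] by (auto simp: g_def complex_eq_iff)
  have "(\<lambda>x. g x / g r) \<in> bounded_functionals X"
    unfolding bounded_functionals_def
    using nz by (auto simp: g_add g_smult add_divide_distrib norm_divide g_le
        intro!: exI[of _ "2 / norm (g r)"] divide_right_mono)
  then show "\<exists>F\<in>bounded_functionals X. F r = 1" using nz by (intro bexI) auto
qed

section \<open>Extension of multilinear forms\<close>

text \<open>Replaces the update at position \<open>i\<close> by a splitting of the list around that
  entry, the shape in which entries are later processed from left to right by induction.\<close>

lemma multilinear_formsI:
  assumes "\<And>xs zs x y a b. length xs + Suc (length zs) = N \<Longrightarrow> set xs \<subseteq> carrier X \<Longrightarrow>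
    set zs \<subseteq> carrier X \<Longrightarrow> x \<in> carrier X \<Longrightarrow> y \<in> carrier X \<Longrightarrow>
    A (xs @ (a \<odot>\<^bsub>X\<^esub> x \<oplus>\<^bsub>X\<^esub> b \<odot>\<^bsub>X\<^esub> y) # zs) = a * A (xs @ x # zs) + b * A (xs @ y # zs)"
  shows "A \<in> multilinear_forms N X"
  unfolding multilinear_forms_def
proof (intro CollectI allI impI)
  fix xs i x y a b
  assume "length xs = N" "set xs \<subseteq> carrier X" "i < N" "x \<in> carrier X" "y \<in> carrier X"
  moreover from this have "set (take i xs) \<subseteq> carrier X" "set (drop (Suc i) xs) \<subseteq> carrier X"
    by (auto dest: in_set_takeD in_set_dropD)
  ultimately show "A (xs[i := a \<odot>\<^bsub>X\<^esub> x \<oplus>\<^bsub>X\<^esub> b \<odot>\<^bsub>X\<^esub> y]) = a * A (xs[i := x]) + b * A (xs[i := y])"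
    using assms[of "take i xs" "drop (Suc i) xs" x y a b] by (simp add: upd_conv_take_nth_drop)
qed

lemma multilinear_formsD:
  assumes "A \<in> multilinear_forms N X" "length xs + Suc (length zs) = N" "set xs \<subseteq> carrier X"
    "set zs \<subseteq> carrier X" "x \<in> carrier X" "y \<in> carrier X"
  shows "A (xs @ (a \<odot>\<^bsub>X\<^esub> x \<oplus>\<^bsub>X\<^esub> b \<odot>\<^bsub>X\<^esub> y) # zs) = a * A (xs @ x # zs) + b * A (xs @ y # zs)"
proof -
  have "A ((xs @ x # zs)[length xs := a \<odot>\<^bsub>X\<^esub> x \<oplus>\<^bsub>X\<^esub> b \<odot>\<^bsub>X\<^esub> y]) =
      a * A ((xs @ x # zs)[length xs := x]) + b * A ((xs @ x # zs)[length xs := y])"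
    by (rule assms(1)[unfolded multilinear_forms_def mem_Collect_eq, rule_format]) (use assms in auto)
  then show ?thesis by simp
qed

section \<open>Subspaces and finite rank operators\<close>

definition linear_subspace :: "('k, 'a) normed_space \<Rightarrow> 'a set \<Rightarrow> bool"
  where "linear_subspace X S \<longleftrightarrow> S \<subseteq> carrier X \<and> \<zero>\<^bsub>X\<^esub> \<in> S \<and>
    (\<forall>x\<in>S. \<forall>y\<in>S. x \<oplus>\<^bsub>X\<^esub> y \<in> S) \<and> (\<forall>c. \<forall>x\<in>S. c \<odot>\<^bsub>X\<^esub> x \<in> S)"

text \<open>The operator that sends \<open>y\<close> to the sum of the vectors
  \<open>F y \<odot> e\<close> over the pairs \<open>(F, e)\<close>; the list lets the projection
  grow by one rank-one term at a time.\<close>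

primrec finite_rank :: "('k, 'a) normed_space \<Rightarrow> (('a \<Rightarrow> 'k) \<times> 'a) list \<Rightarrow> 'a \<Rightarrow> 'a"
  where
    "finite_rank X [] y = \<zero>\<^bsub>X\<^esub>"
  | "finite_rank X (p # L) y = fst p y \<odot>\<^bsub>X\<^esub> snd p \<oplus>\<^bsub>X\<^esub> finite_rank X L y"

lemma norm_sum_list_le_mult:
  fixes f :: "'p \<Rightarrow> 'a \<Rightarrow> 'b::real_normed_vector"
  assumes "\<And>p. p \<in> set L \<Longrightarrow> \<exists>C\<ge>0. \<forall>y\<in>V. norm (f p y) \<le> C * g y"
  shows "\<exists>C\<ge>0. \<forall>y\<in>V. norm (\<Sum>p\<leftarrow>L. f p y) \<le> C * g y"
  using assms
proof (induction L)
  case (Cons p L)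
  then obtain C where C: "C \<ge> 0" "\<And>y. y \<in> V \<Longrightarrow> norm (\<Sum>p\<leftarrow>L. f p y) \<le> C * g y" by auto
  obtain D where D: "D \<ge> 0" "\<And>y. y \<in> V \<Longrightarrow> norm (f p y) \<le> D * g y"
    using Cons.prems[of p] by auto
  show ?case
  proof (intro exI[of _ "D + C"] conjI ballI)
    fix y assume "y \<in> V"
    then show "norm (\<Sum>p\<leftarrow>p # L. f p y) \<le> (D + C) * g y"
      using C(2)[of y] D(2)[of y] norm_triangle_ineq[of "f p y" "\<Sum>p\<leftarrow>L. f p y"]
      by (simp add: distrib_right)
  qed (use C D in simp)
qed (auto intro: exI[of _ 0])

context normed_space
begin

lemma multilinear_add:
  assumes "A \<in> multilinear_forms N X" "length xs + Suc (length zs) = N" "set xs \<subseteq> carrier X"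
    "set zs \<subseteq> carrier X" "x \<in> carrier X" "y \<in> carrier X"
  shows "A (xs @ (x \<oplus> y) # zs) = A (xs @ x # zs) + A (xs @ y # zs)"
  using multilinear_formsD[OF assms, of 1 1] assms by simp

lemma multilinear_smult:
  assumes "A \<in> multilinear_forms N X" "length xs + Suc (length zs) = N" "set xs \<subseteq> carrier X"
    "set zs \<subseteq> carrier X" "x \<in> carrier X"
  shows "A (xs @ (c \<odot> x) # zs) = c * A (xs @ x # zs)"
  using multilinear_formsD[OF assms assms(5), of c 0] assms by simp

lemma linear_subspace_carrier: "linear_subspace X (carrier X)"
  by (simp add: linear_subspace_def)

lemma normed_space_subspace:
  assumes "linear_subspace X S" shows "normed_space (X\<lparr>carrier := S\<rparr>)"
  by (rule normed_spaceI)
    (use assms in \<open>auto simp: linear_subspace_def subset_iff M.a_ac smult_add_left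
      smult_add_right smult_smult nrm_smult nrm_triangle nrm_eq_zero_iff\<close>)

lemma ndist_subspace:
  assumes "linear_subspace X S" "x \<in> S" "y \<in> S"
  shows "ndist (X\<lparr>carrier := S\<rparr>) x y = ndist X x y"
proof -
  interpret Y: normed_space "X\<lparr>carrier := S\<rparr>" by (rule normed_space_subspace[OF assms(1)])
  have "x \<in> carrier X" "y \<in> carrier X" using assms by (auto simp: linear_subspace_def)
  then show ?thesis using Y.ndist_eq[of x y] assms by (simp add: ndist_eq)
qed

lemma bounded_functionalsE:
  assumes "F \<in> bounded_functionals X"
  obtains K where "K \<ge> 0" "\<And>x. x \<in> carrier X \<Longrightarrow> norm (F x) \<le> K * nrm X x"
proof -
  obtain K where K: "\<And>x. x \<in> carrier X \<Longrightarrow> norm (F x) \<le> K * nrm X x"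
    using assms unfolding bounded_functionals_def by blast
  have "norm (F x) \<le> \<bar>K\<bar> * nrm X x" if "x \<in> carrier X" for x
    using K[OF that] nrm_nonneg[OF that] by (smt (verit) mult_right_mono)
  then show ?thesis using that[of "\<bar>K\<bar>"] by simp
qed

lemma finite_rank_in_subspace:
  assumes "linear_subspace X S" "set L \<subseteq> bounded_functionals X \<times> S"
  shows "finite_rank X L y \<in> S"
  using assms(2,1) by (induction L) (auto simp: linear_subspace_def)

context
  fixes S L
  assumes S: "linear_subspace X S" and L: "set L \<subseteq> bounded_functionals X \<times> S"
begin

lemma finite_rank_linear:
  assumes "x \<in> carrier X" "y \<in> carrier X"
  shows "finite_rank X L (a \<odot> x \<oplus> b \<odot> y) = a \<odot> finite_rank X L x \<oplus> b \<odot> finite_rank X L y"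
  using L
proof (induction L)
  case (Cons p L)
  obtain F e where p: "p = (F, e)" "F \<in> bounded_functionals X" "e \<in> carrier X"
    using Cons.prems S by (auto simp: linear_subspace_def)
  have P: "finite_rank X L z \<in> carrier X" for z
    using finite_rank_in_subspace[OF S, of L z] Cons.prems S by (auto simp: linear_subspace_def)
  have "F (a \<odot> x \<oplus> b \<odot> y) = a * F x + b * F y"
    using p(2) assms by (simp add: bounded_functionals_def)
  then show ?case
    using Cons p P assms
    by (simp add: smult_add_left smult_add_right smult_smult M.a_ac)
qed simp

lemma finite_rank_bounded:
  "\<exists>K\<ge>0. \<forall>y\<in>carrier X. nrm X (finite_rank X L y) \<le> K * nrm X y"
  using L
proof (induction L)
  case (Cons p L)
  then obtain K where K: "K \<ge> 0" "\<And>y. y \<in> carrier X \<Longrightarrow> nrm X (finite_rank X L y) \<le> K * nrm X y"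
    by auto
  obtain F e where p: "p = (F, e)" "F \<in> bounded_functionals X" "e \<in> carrier X"
    using Cons.prems S by (auto simp: linear_subspace_def)
  obtain M where M: "M \<ge> 0" "\<And>x. x \<in> carrier X \<Longrightarrow> norm (F x) \<le> M * nrm X x"
    by (rule bounded_functionalsE[OF p(2)]) (blast intro: that)
  have P: "finite_rank X L z \<in> carrier X" for z
    using finite_rank_in_subspace[OF S, of L z] Cons.prems S by (auto simp: linear_subspace_def)
  show ?case
  proof (intro exI[of _ "M * nrm X e + K"] conjI ballI)
    fix y assume y: "y \<in> carrier X"
    have "nrm X (finite_rank X (p # L) y) \<le> norm (F y) * nrm X e + nrm X (finite_rank X L y)"
      using p P nrm_triangle[of "F y \<odot> e" "finite_rank X L y"] by (simp add: nrm_smult)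
    also have "\<dots> \<le> M * nrm X y * nrm X e + K * nrm X y"
      using M(2)[OF y] K(2)[OF y] nrm_nonneg[OF p(3)] by (intro add_mono mult_right_mono)
    finally show "nrm X (finite_rank X (p # L) y) \<le> (M * nrm X e + K) * nrm X y"
      by (simp add: algebra_simps)
  qed (use M K nrm_nonneg[OF p(3)] in simp)
qed (auto intro: exI[of _ 0])

lemma multilinear_finite_rank:
  assumes A: "A \<in> multilinear_forms N (X\<lparr>carrier := S\<rparr>)"
    and "length xs + Suc (length zs) = N" "set xs \<subseteq> S" "set zs \<subseteq> S"
  shows "A (xs @ finite_rank X L y # zs) = (\<Sum>p\<leftarrow>L. fst p y * A (xs @ snd p # zs))"
proof -
  interpret Y: normed_space "X\<lparr>carrier := S\<rparr>" by (rule normed_space_subspace[OF S])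
  show ?thesis
    using L
  proof (induction L)
    case Nil
    show ?case using Y.multilinear_smult[OF A assms(2), of "\<zero>" 0] assms S
      by (simp add: linear_subspace_def)
  next
    case (Cons p L)
    have *: "snd p \<in> S" using Cons.prems by auto
    have P: "finite_rank X L z \<in> S" for z
      using finite_rank_in_subspace[OF S, of L z] Cons.prems by auto
    have "c \<odot> snd p \<in> S" for c using * S by (auto simp: linear_subspace_def)
    then show ?case
      using Cons Y.multilinear_add[OF A assms(2), of "fst p y \<odot> snd p" "finite_rank X L y"]
        Y.multilinear_smult[OF A assms(2), of "snd p" "fst p y"] P * assms by simp
  qed
qed

text \<open>The form \<open>A\<close> itself may be unbounded. Expanding slot after slot leaves
  bounded functionals of \<open>y\<close> times values of \<open>A\<close> at the finitely many
  vectors in \<open>L\<close>. The list \<open>xs\<close> holds the slots already expanded; once all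
  are, the value of \<open>A\<close> is a constant.\<close>

lemma multilinear_finite_rank_bounded:
  assumes A: "A \<in> multilinear_forms N (X\<lparr>carrier := S\<rparr>)" and "length xs + m = N" "set xs \<subseteq> S"
  shows "\<exists>C\<ge>0. \<forall>y\<in>carrier X.
    norm (A (xs @ replicate m (finite_rank X L y))) \<le> C * nrm X y ^ m"
  using assms(2,3)
proof (induction m arbitrary: xs)
  case (Suc m)
  have eq: "A (xs @ replicate (Suc m) (finite_rank X L y)) =
      (\<Sum>p\<leftarrow>L. fst p y * A (xs @ snd p # replicate m (finite_rank X L y)))" for y
    using multilinear_finite_rank[OF A, of xs "replicate m (finite_rank X L y)" y] Suc.prems
      finite_rank_in_subspace[OF S L] by (auto simp: set_replicate_conv_if)
  show ?case
    unfolding eq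
  proof (rule norm_sum_list_le_mult)
    fix p assume p: "p \<in> set L"
    then obtain F e where Fe: "p = (F, e)" "F \<in> bounded_functionals X" "e \<in> S" using L by auto
    obtain K where K: "K \<ge> 0" "\<And>x. x \<in> carrier X \<Longrightarrow> norm (F x) \<le> K * nrm X x"
      by (rule bounded_functionalsE[OF Fe(2)]) (blast intro: that)
    obtain C where C: "C \<ge> 0" "\<And>y. y \<in> carrier X \<Longrightarrow>
        norm (A (xs @ e # replicate m (finite_rank X L y))) \<le> C * nrm X y ^ m"
      using Suc.IH[of "xs @ [e]"] Suc.prems Fe by auto
    have "norm (F y * A (xs @ e # replicate m (finite_rank X L y))) \<le> (K * C) * nrm X y ^ Suc m"
      if y: "y \<in> carrier X" for y
    proof -
      have "norm (F y * A (xs @ e # replicate m (finite_rank X L y))) \<le>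
          (K * nrm X y) * (C * nrm X y ^ m)"
        unfolding norm_mult using K C y nrm_nonneg[OF y] by (intro mult_mono) auto
      then show ?thesis by (simp add: algebra_simps)
    qed
    then show "\<exists>C\<ge>0. \<forall>y\<in>carrier X.
        norm (fst p y * A (xs @ snd p # replicate m (finite_rank X L y))) \<le> C * nrm X y ^ Suc m"
      using Fe K C by (intro exI[of _ "K * C"]) auto
  qed
next
  case 0
  then show ?case by (intro exI[of _ "norm (A xs)"]) simp
qed

end

text \<open>Points are added one at a time. If the present operator misses \<open>y\<close> by
  \<open>r\<close>, a rank-one term with vector \<open>r\<close> corrects it, provided that its
  functional is 1 at \<open>y\<close> and 0 at the points already fixed.\<close>

lemma finite_rank_projection:
  assumes "functionals_separate X" "linear_subspace X S" "set ys \<subseteq> S"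
  shows "\<exists>L. set L \<subseteq> bounded_functionals X \<times> S \<and> (\<forall>y\<in>set ys. finite_rank X L y = y)"
  using assms(3)
proof (induction ys)
  case (Cons y ys)
  then obtain L where L: "set L \<subseteq> bounded_functionals X \<times> S" "\<And>y. y \<in> set ys \<Longrightarrow> finite_rank X L y = y"
    by auto
  let ?P = "finite_rank X L"
  have SX: "z \<in> carrier X" if "z \<in> S" for z using that assms(2) by (auto simp: linear_subspace_def)
  have PS: "?P z \<in> S" for z by (rule finite_rank_in_subspace[OF assms(2) L(1)])
  have [simp]: "?P z \<in> carrier X" for z using PS by (rule SX)
  define r where "r = y \<oplus> (- 1) \<odot> ?P y"
  have y: "y \<in> carrier X" "y \<in> S" using Cons.prems SX by auto
  have eq: "?P y \<oplus> r = y" using y by (simp add: r_def add_minus_cancel)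
  have r: "r \<in> S" "r \<in> carrier X"
    using y PS[of y] assms(2) SX by (auto simp: r_def linear_subspace_def)
  show ?case
  proof (cases "r = \<zero>")
    case True
    then have "?P y = y" using eq by simp
    then show ?thesis using L by (intro exI[of _ L]) auto
  next
    case False
    then obtain F where F: "F \<in> bounded_functionals X" "F r = 1"
      using assms(1) r by (auto simp: functionals_separate_def)
    \<comment> \<open>Precomposing \<open>F\<close> with identity minus \<open>?P\<close> makes it
      vanish on all points fixed by \<open>?P\<close>, while at \<open>y\<close> it returns
      \<open>F r\<close>, which is 1.\<close>
    define G where "G z = F (z \<oplus> (- 1) \<odot> ?P z)" for z
    obtain K where K: "K \<ge> 0" "\<And>x. x \<in> carrier X \<Longrightarrow> norm (F x) \<le> K * nrm X x"
      by (rule bounded_functionalsE[OF F(1)]) (blast intro: that)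
    obtain M where M: "\<And>x. x \<in> carrier X \<Longrightarrow> nrm X (?P x) \<le> M * nrm X x"
      using finite_rank_bounded[OF assms(2) L(1)] by auto
    have F_lin: "F (x \<oplus> z) = F x + F z" "F (c \<odot> x) = c * F x"
      if "x \<in> carrier X" "z \<in> carrier X" for x z c
      using F(1) that by (auto simp: bounded_functionals_def)
    have P_lin: "?P (x \<oplus> z) = ?P x \<oplus> ?P z" "?P (c \<odot> x) = c \<odot> ?P x"
      if "x \<in> carrier X" "z \<in> carrier X" for x z c
      using finite_rank_linear[OF assms(2) L(1) that, of 1 1]
        finite_rank_linear[OF assms(2) L(1) that, of c 0] that by simp_all
    have "norm (G z) \<le> (K * (1 + M)) * nrm X z" if z: "z \<in> carrier X" for z
    proof -
      have "norm (G z) \<le> K * nrm X (z \<oplus> (- 1) \<odot> ?P z)" using K(2) z by (simp add: G_def)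
      also have "\<dots> \<le> K * (nrm X z + nrm X (?P z))"
        using nrm_triangle[of z "(- 1) \<odot> ?P z"] K(1) z by (simp add: nrm_smult mult_left_mono)
      also have "\<dots> \<le> K * (nrm X z + M * nrm X z)" using M[OF z] K(1) by (simp add: mult_left_mono)
      finally show ?thesis by (simp add: algebra_simps)
    qed
    then have G: "G \<in> bounded_functionals X"
      unfolding bounded_functionals_def G_def
      by (auto simp: F_lin P_lin algebra_simps intro!: exI[of _ "K * (1 + M)"])
    have "finite_rank X ((G, r) # L) z = z" if "z \<in> set (y # ys)" for z
    proof (cases "z \<in> set ys")
      case True
      then have "z \<in> carrier X" using Cons.prems SX by auto
      then show ?thesis using L(2)[OF True] r F_lin(2)[of "\<zero>" "\<zero>" 0] by (simp add: G_def)
    next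
      case False
      then show ?thesis using that eq r y F(2) by (simp add: G_def flip: r_def) (simp add: M.a_comm)
    qed
    then show ?thesis using L(1) G r by (intro exI[of _ "(G, r) # L"]) auto
  qed
qed (auto intro: exI[of _ "[]"])

text \<open>\<open>B\<close> is \<open>A\<close> with the finite rank operator applied in every
  slot. With \<open>S\<close> the whole carrier this exchanges an unbounded form for one bounded on
  the diagonal; with a proper subspace it moves a form to the larger space. Away from
  \<open>T\<close> the values of \<open>B\<close> on \<open>S\<close> may differ from those of
  \<open>A\<close>.\<close>

lemma bounded_multilinear_extension:
  assumes "functionals_separate X" "linear_subspace X S" "finite T" "T \<subseteq> S"
    and A: "A \<in> multilinear_forms N (X\<lparr>carrier := S\<rparr>)"
  obtains B C where "B \<in> multilinear_forms N X"
    "\<And>y. y \<in> T \<Longrightarrow> B (replicate N y) = A (replicate N y)"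
    "0 \<le> C" "\<And>y. y \<in> carrier X \<Longrightarrow> norm (B (replicate N y)) \<le> C * nrm X y ^ N"
proof -
  obtain ys where "set ys = T" using finite_list[OF assms(3)] by blast
  then obtain L where L: "set L \<subseteq> bounded_functionals X \<times> S" "\<And>y. y \<in> T \<Longrightarrow> finite_rank X L y = y"
    using finite_rank_projection[OF assms(1,2), of ys] assms(4) by auto
  have PS: "finite_rank X L z \<in> S" for z by (rule finite_rank_in_subspace[OF assms(2) L(1)])
  obtain C where "C \<ge> 0"
      "\<And>y. y \<in> carrier X \<Longrightarrow> norm (A (replicate N (finite_rank X L y))) \<le> C * nrm X y ^ N"
    using multilinear_finite_rank_bounded[OF assms(2) L(1) A, of "[]" N] by auto
  moreover have "(\<lambda>xs. A (map (finite_rank X L) xs)) \<in> multilinear_forms N X"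
  proof (rule multilinear_formsI)
    fix xs zs :: "'a list" and x y a b
    assume "length xs + Suc (length zs) = N" "x \<in> carrier X" "y \<in> carrier X"
    then show "A (map (finite_rank X L) (xs @ (a \<odot> x \<oplus> b \<odot> y) # zs)) =
        a * A (map (finite_rank X L) (xs @ x # zs)) + b * A (map (finite_rank X L) (xs @ y # zs))"
      using multilinear_formsD[OF A, of "map (finite_rank X L) xs" "map (finite_rank X L) zs"
          "finite_rank X L x" "finite_rank X L y" a b] PS
      by (auto simp: finite_rank_linear[OF assms(2) L(1)])
  qed
  ultimately show ?thesis using L(2) that[of "\<lambda>xs. A (map (finite_rank X L) xs)" C] by simp
qed

end

section \<open>The projective symmetric norm\<close>

lemma tensor_power_apply:
  "tensor_power N X z A = (if A \<in> multilinear_forms N X then A (replicate N z) else 0)"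
  by (simp add: tensor_power_def elementary_tensor_def)

lemma sym_tensors_simps [simp]:
  "u \<oplus>\<^bsub>sym_tensors N X\<^esub> v = (\<lambda>A. u A + v A)"
  "c \<odot>\<^bsub>sym_tensors N X\<^esub> u = (\<lambda>A. c * u A)"
  "\<zero>\<^bsub>sym_tensors N X\<^esub> = (\<lambda>A. 0)"
  "nrm (sym_tensors N X) = proj_sym_norm N X"
  by (simp_all add: sym_tensors_def)

lemma sum_concat:
  fixes n m :: nat
  shows "(\<Sum>k<n + m. if k < n then f k else g (k - n)) = (\<Sum>k<n. f k) + (\<Sum>k<m. g k)"
  by (induction m) (auto simp: ac_simps)

text \<open>Adding 1 to the denominator covers \<open>a = 0\<close> in the epsilon
  estimates.\<close>

lemma mult_divide_add_one_le:
  fixes a e :: real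
  assumes "0 \<le> a" "0 \<le> e"
  shows "a * (e / (a + 1)) \<le> e"
proof -
  have "a * e \<le> e * (a + 1)" using assms by (simp add: algebra_simps)
  then show ?thesis using assms by (simp add: pos_divide_le_eq)
qed

lemma power_comb_add:
  "(\<lambda>A. power_comb N X n c x A + power_comb N X m d y A) =
    power_comb N X (n + m) (\<lambda>k. if k < n then c k else d (k - n)) (\<lambda>k. if k < n then x k else y (k - n))"
  by (rule ext) (simp add: power_comb_def if_distrib if_distribR flip: sum_concat cong: if_cong)

lemma power_comb_smult:
  "(\<lambda>A. a * power_comb N X n c x A) = power_comb N X n (\<lambda>k. a * c k) x"
  by (simp add: power_comb_def sum_distrib_left mult.assoc)

lemma power_comb_Suc:
  "power_comb N X (Suc n) c x = (\<lambda>A. power_comb N X n c x A + c n * tensor_power N X (x n) A)"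
  by (simp add: power_comb_def)

lemma power_comb_0: "power_comb N X 0 c x = (\<lambda>A. 0)"
  by (simp add: power_comb_def)

lemma power_comb_in_sym_tensors:
  "(\<And>k. k < n \<Longrightarrow> x k \<in> carrier X) \<Longrightarrow> power_comb N X n c x \<in> carrier (sym_tensors N X)"
  by (auto simp: sym_tensors_def)

lemma sym_tensorsE:
  assumes "u \<in> carrier (sym_tensors N X)"
  obtains n c x where "\<And>k. k < n \<Longrightarrow> x k \<in> carrier X" "u = power_comb N X n c x"
  using assms by (auto simp: sym_tensors_def)

lemma tensor_power_in_sym_tensors:
  assumes "x \<in> carrier X" shows "tensor_power N X x \<in> carrier (sym_tensors N X)"
  using power_comb_in_sym_tensors[of 1 "\<lambda>_. x" X N "\<lambda>_. 1"] assms by (simp add: power_comb_def)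

definition unit_rep ::
    "nat \<Rightarrow> ('k::real_normed_field, 'a) normed_space \<Rightarrow> nat \<Rightarrow> (nat \<Rightarrow> 'k) \<Rightarrow> (nat \<Rightarrow> 'a) \<Rightarrow>
     ('k, 'a) tensor \<Rightarrow> bool"
  where "unit_rep N X n c x u \<longleftrightarrow>
    (\<forall>k<n. x k \<in> carrier X \<and> nrm X (x k) = 1) \<and> u = power_comb N X n c x"

lemma proj_sym_norm_eq: "proj_sym_norm N X u = Inf {\<Sum>k<n. norm (c k) | n c x. unit_rep N X n c x u}"
  by (simp add: proj_sym_norm_def unit_rep_def conj_assoc)

lemma proj_sym_norm_le:
  assumes "unit_rep N X n c x u"
  shows "proj_sym_norm N X u \<le> (\<Sum>k<n. norm (c k))"
  unfolding proj_sym_norm_eq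
  by (rule cInf_lower) (use assms in \<open>auto intro!: bdd_belowI[of _ 0] sum_nonneg\<close>)

text \<open>A polynomial of degree at most \<open>N\<close> and its interpolant agree at
  \<open>N + 1\<close> nodes, which are distinct in characteristic 0. The weights \<open>L\<close>
  are fixed before \<open>p\<close>, so one identity serves all forms at once and becomes an
  identity of tensors.\<close>

lemma Lagrange_interpolation:
  obtains L :: "nat \<Rightarrow> 'k::field_char_0 poly" where
    "\<And>p t. degree p \<le> N \<Longrightarrow> poly p t = (\<Sum>j\<le>N. poly (L j) t * poly p (of_nat j))"
proof
  define L :: "nat \<Rightarrow> 'k poly" where
    "L j = Polynomial.smult (inverse (\<Prod>i\<in>{..N} - {j}. of_nat j - of_nat i))
      (\<Prod>i\<in>{..N} - {j}. [:- of_nat i, 1:])" for j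
  have L_node: "poly (L j) (of_nat i) = (if i = j then 1 else 0)" if "i \<le> N" "j \<le> N" for i j
  proof (cases "i = j")
    case True
    have "(\<Prod>i\<in>{..N} - {j}. of_nat j - of_nat i) \<noteq> (0 :: 'k)" by auto
    then show ?thesis using True by (simp add: L_def poly_prod)
  next
    case False
    then have "i \<in> {..N} - {j}" using that by auto
    then have "(\<Prod>k\<in>{..N} - {j}. (of_nat i - of_nat k) :: 'k) = 0" by (intro prod_zero) auto
    then show ?thesis using False by (simp add: L_def poly_prod)
  qed
  have L_degree: "degree (L j) \<le> N" if "j \<le> N" for j
  proof -
    have "degree (L j) \<le> degree (\<Prod>i\<in>{..N} - {j}. [:- of_nat i, 1:] :: 'k poly)"
      unfolding L_def by (rule degree_smult_le)
    also have "\<dots> \<le> (\<Sum>i\<in>{..N} - {j}. 1)"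
      by (rule order_trans[OF degree_prod_sum_le]) auto
    finally show ?thesis using that by simp
  qed
  fix p :: "'k poly" and t assume p: "degree p \<le> N"
  define q where "q = (\<Sum>j\<le>N. Polynomial.smult (poly p (of_nat j)) (L j))"
  have "degree q \<le> N"
    unfolding q_def by (rule degree_sum_le) (auto intro: order_trans[OF degree_smult_le] L_degree)
  have card: "card (of_nat ` {..N} :: 'k set) = Suc N"
    by (subst card_image) (auto intro: inj_onI)
  have "p = q"
  proof (rule poly_eqI_degree[of "of_nat ` {..N}"])
    fix x :: 'k assume "x \<in> of_nat ` {..N}"
    then obtain i where i: "i \<le> N" "x = of_nat i" by auto
    have "poly q x = (\<Sum>j\<le>N. poly p (of_nat j) * (if i = j then 1 else 0))"
      unfolding q_def poly_sum poly_smult i(2) using i(1) L_node by (intro sum.cong) auto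
    also have "\<dots> = poly p x" using i by (simp add: if_distrib cong: if_cong)
    finally show "poly p x = poly q x" by simp
  qed (use card p \<open>degree q \<le> N\<close> in auto)
  then show "poly p t = (\<Sum>j\<le>N. poly (L j) t * poly p (of_nat j))"
    by (metis (no_types, lifting) q_def poly_smult poly_sum mult.commute sum.cong)
qed

section \<open>Multilinear forms along multiples and lines\<close>

context normed_space
begin

lemma multilinear_smult_replicate:
  assumes A: "A \<in> multilinear_forms N X" and x: "x \<in> carrier X"
    and "length xs + m = N" "set xs \<subseteq> carrier X"
  shows "A (xs @ replicate m (t \<odot> x)) = t ^ m * A (xs @ replicate m x)"
  using assms(3,4)
proof (induction m arbitrary: xs)
  case (Suc m)
  have "A (xs @ replicate (Suc m) (t \<odot> x)) = t * A (xs @ x # replicate m (t \<odot> x))"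
    using multilinear_smult[OF A, of xs "replicate m (t \<odot> x)" x t] Suc.prems x
    by (auto simp: set_replicate_conv_if)
  also have "A (xs @ x # replicate m (t \<odot> x)) = t ^ m * A (xs @ x # replicate m x)"
    using Suc.IH[of "xs @ [x]"] Suc.prems x by simp
  finally show ?case by simp
qed simp

lemma tensor_power_smult:
  assumes "x \<in> carrier X"
  shows "tensor_power N X (t \<odot> x) A = t ^ N * tensor_power N X x A"
  using multilinear_smult_replicate[of A N x "[]" N t] assms by (simp add: tensor_power_apply)

text \<open>Expanding one slot by linearity gives the polynomial with \<open>y\<close> in that slot
  plus \<open>t\<close> times the one with \<open>g\<close> there; \<open>pCons 0\<close> is this
  multiplication by \<open>t\<close>.\<close>

lemma multilinear_line_poly:
  assumes A: "A \<in> multilinear_forms N X" and yg: "y \<in> carrier X" "g \<in> carrier X"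
    and "length xs + m = N" "set xs \<subseteq> carrier X"
  shows "\<exists>p. degree p \<le> m \<and> (\<forall>t. A (xs @ replicate m (y \<oplus> t \<odot> g)) = poly p t)"
  using assms(4,5)
proof (induction m arbitrary: xs)
  case 0
  then show ?case by (intro exI[of _ "[:A xs:]"]) auto
next
  case (Suc m)
  obtain p where p: "degree p \<le> m" "\<And>t. A (xs @ y # replicate m (y \<oplus> t \<odot> g)) = poly p t"
    using Suc.IH[of "xs @ [y]"] Suc.prems yg by auto
  obtain q where q: "degree q \<le> m" "\<And>t. A (xs @ g # replicate m (y \<oplus> t \<odot> g)) = poly q t"
    using Suc.IH[of "xs @ [g]"] Suc.prems yg by auto
  have "A (xs @ replicate (Suc m) (y \<oplus> t \<odot> g)) = poly (p + pCons 0 q) t" for t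
    using multilinear_formsD[OF A, of xs "replicate m (y \<oplus> t \<odot> g)" y g 1 t] Suc.prems yg
    by (auto simp: set_replicate_conv_if p(2) q(2))
  moreover have "degree (p + pCons 0 q) \<le> Suc m"
    using p(1) q(1) by (intro degree_add_le) (auto simp: degree_pCons_le intro: order_trans[OF degree_pCons_le])
  ultimately show ?case by blast
qed

end

section \<open>The norm axioms for symmetric tensors\<close>

locale sym_tensor_space = normed_space X
  for X :: "('k::real_normed_field, 'a) normed_space" (structure) +
  fixes N :: nat
  assumes N: "N \<ge> 1" and sep: "functionals_separate X"
begin

text \<open>Each vector is scaled to norm 1 and the \<open>N\<close>-th power of its norm moves into
  the coefficient. Without unit vectors the space is zero, all powers vanish because
  \<open>N \<ge> 1\<close>, and the empty representation serves.\<close>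

lemma unit_rep_exists:
  assumes x: "\<And>k. k < n \<Longrightarrow> x k \<in> carrier X"
  shows "\<exists>n' c' x'. unit_rep N X n' c' x' (power_comb N X n c x) \<and>
    (\<Sum>k<n'. norm (c' k)) = (\<Sum>k<n. norm (c k) * nrm X (x k) ^ N)"
proof (cases "\<exists>e\<in>carrier X. nrm X e = 1")
  case True
  then obtain e where e: "e \<in> carrier X" "nrm X e = 1" by blast
  define c' where "c' k = c k * of_real (nrm X (x k) ^ N)" for k
  \<comment> \<open>A zero vector is replaced by an arbitrary unit vector \<open>e\<close>, which is
    harmless because its new coefficient is 0.\<close>
  define x' where "x' k = (if nrm X (x k) = 0 then e else of_real (1 / nrm X (x k)) \<odot> x k)" for k
  have "c' k * tensor_power N X (x' k) A = c k * tensor_power N X (x k) A" if "k < n" for k A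
  proof (cases "nrm X (x k) = 0")
    case True
    then have "x k = \<zero>" using x[OF that] nrm_eq_zero_iff by simp
    then have "tensor_power N X (x k) A = 0"
      using tensor_power_smult[of "\<zero>" N 0 A] N by (simp add: power_0_left)
    then show ?thesis using True N by (simp add: c'_def power_0_left)
  next
    case False
    then show ?thesis
      using x[OF that] by (simp add: c'_def x'_def tensor_power_smult power_divide)
  qed
  then have "power_comb N X n c x = power_comb N X n c' x'"
    unfolding power_comb_def by (intro ext sum.cong) auto
  moreover have "x' k \<in> carrier X \<and> nrm X (x' k) = 1" if "k < n" for k
    using x[OF that] e nrm_nonneg[of "x k"] by (auto simp: x'_def nrm_smult norm_divide)
  moreover have "(\<Sum>k<n. norm (c' k)) = (\<Sum>k<n. norm (c k) * nrm X (x k) ^ N)"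
    using x nrm_nonneg by (intro sum.cong) (auto simp: c'_def norm_mult norm_power)
  ultimately show ?thesis unfolding unit_rep_def by blast
next
  case False
  have 0: "x k = \<zero>" if "k < n" for k
  proof (rule ccontr)
    assume "x k \<noteq> \<zero>"
    then have "nrm X (x k) \<noteq> 0" using x[OF that] nrm_eq_zero_iff by simp
    then have "nrm X (of_real (1 / nrm X (x k)) \<odot> x k) = 1"
      using x[OF that] nrm_nonneg[of "x k"] by (simp add: nrm_smult norm_divide)
    then show False using False x[OF that] by (meson smult_in_carrier)
  qed
  have "tensor_power N X (x k) A = 0" if "k < n" for k A
    using tensor_power_smult[of "\<zero>" N 0 A] N 0[OF that] by (simp add: power_0_left)
  then have "unit_rep N X 0 c x (power_comb N X n c x)"
    by (simp add: unit_rep_def power_comb_def)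
  moreover have "(\<Sum>k<n. norm (c k) * nrm X (x k) ^ N) = 0"
    using 0 N by (simp add: power_0_left)
  ultimately show ?thesis by (metis lessThan_0 sum.empty)
qed

lemma proj_sym_norm_power_comb_le:
  assumes "\<And>k. k < n \<Longrightarrow> x k \<in> carrier X"
  shows "proj_sym_norm N X (power_comb N X n c x) \<le> (\<Sum>k<n. norm (c k) * nrm X (x k) ^ N)"
  using unit_rep_exists[of n x c, OF assms] proj_sym_norm_le by metis

text \<open>The infimum of an empty set of reals would carry no information; nonemptiness gives
  lower bounds for the norm and nearly optimal representations.\<close>

lemma unit_reps_nonempty:
  assumes "u \<in> carrier (sym_tensors N X)"
  shows "{\<Sum>k<n. norm (c k) | n c x. unit_rep N X n c x u} \<noteq> {}"
proof -
  obtain n c x where "\<And>k. k < n \<Longrightarrow> x k \<in> carrier X" "u = power_comb N X n c x"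
    using assms by (rule sym_tensorsE) (blast intro: that)
  then show ?thesis using unit_rep_exists[of n x c] by blast
qed

lemma proj_sym_norm_approx:
  assumes "u \<in> carrier (sym_tensors N X)" "e > 0"
  obtains n c x where "unit_rep N X n c x u" "(\<Sum>k<n. norm (c k)) < proj_sym_norm N X u + e"
proof -
  have "Inf {\<Sum>k<n. norm (c k) | n c x. unit_rep N X n c x u} < proj_sym_norm N X u + e"
    unfolding proj_sym_norm_eq by (rule less_add_same_cancel1[THEN iffD2, OF assms(2)])
  from cInf_lessD[OF unit_reps_nonempty[OF assms(1)] this] show ?thesis using that by blast
qed

lemma proj_sym_norm_nonneg:
  assumes "u \<in> carrier (sym_tensors N X)" shows "0 \<le> proj_sym_norm N X u"
  unfolding proj_sym_norm_eq
  by (rule cInf_greatest[OF unit_reps_nonempty[OF assms]]) (auto intro: sum_nonneg)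

lemma proj_sym_norm_triangle:
  assumes "u \<in> carrier (sym_tensors N X)" "v \<in> carrier (sym_tensors N X)"
  shows "proj_sym_norm N X (\<lambda>A. u A + v A) \<le> proj_sym_norm N X u + proj_sym_norm N X v"
proof (rule field_le_epsilon)
  fix e :: real assume "e > 0"
  obtain n c x where 1: "unit_rep N X n c x u" "(\<Sum>k<n. norm (c k)) < proj_sym_norm N X u + e / 2"
    using proj_sym_norm_approx[OF assms(1), of "e / 2"] \<open>e > 0\<close> by auto
  obtain m d y where 2: "unit_rep N X m d y v" "(\<Sum>k<m. norm (d k)) < proj_sym_norm N X v + e / 2"
    using proj_sym_norm_approx[OF assms(2), of "e / 2"] \<open>e > 0\<close> by auto
  have "unit_rep N X (n + m) (\<lambda>k. if k < n then c k else d (k - n))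
      (\<lambda>k. if k < n then x k else y (k - n)) (\<lambda>A. u A + v A)"
    using 1(1) 2(1) by (auto simp: unit_rep_def power_comb_add)
  from proj_sym_norm_le[OF this]
  have "proj_sym_norm N X (\<lambda>A. u A + v A) \<le> (\<Sum>k<n. norm (c k)) + (\<Sum>k<m. norm (d k))"
    by (simp add: if_distrib[of norm] flip: sum_concat cong: if_cong)
  then show "proj_sym_norm N X (\<lambda>A. u A + v A) \<le> proj_sym_norm N X u + proj_sym_norm N X v + e"
    using 1(2) 2(2) by simp
qed

lemma smult_in_sym_tensors:
  "u \<in> carrier (sym_tensors N X) \<Longrightarrow> (\<lambda>A. a * u A) \<in> carrier (sym_tensors N X)"
  by (auto elim!: sym_tensorsE simp: power_comb_smult intro!: power_comb_in_sym_tensors)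

lemma proj_sym_norm_smult_le:
  assumes "u \<in> carrier (sym_tensors N X)"
  shows "proj_sym_norm N X (\<lambda>A. a * u A) \<le> norm a * proj_sym_norm N X u"
proof (rule field_le_epsilon)
  fix e :: real assume "e > 0"
  then have e': "e / (norm a + 1) > 0" by (simp add: add_nonneg_pos)
  obtain n c x where 1: "unit_rep N X n c x u"
      "(\<Sum>k<n. norm (c k)) < proj_sym_norm N X u + e / (norm a + 1)"
    using proj_sym_norm_approx[OF assms e'] by auto
  have "unit_rep N X n (\<lambda>k. a * c k) x (\<lambda>A. a * u A)"
    using 1(1) by (auto simp: unit_rep_def power_comb_smult)
  from proj_sym_norm_le[OF this]
  have "proj_sym_norm N X (\<lambda>A. a * u A) \<le> norm a * (\<Sum>k<n. norm (c k))"
    by (simp add: norm_mult sum_distrib_left)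
  also have "\<dots> \<le> norm a * (proj_sym_norm N X u + e / (norm a + 1))"
    using 1(2) by (intro mult_left_mono) auto
  also have "\<dots> \<le> norm a * proj_sym_norm N X u + e"
    using mult_divide_add_one_le[of "norm a" e] \<open>e > 0\<close> by (simp add: distrib_left)
  finally show "proj_sym_norm N X (\<lambda>A. a * u A) \<le> norm a * proj_sym_norm N X u + e" .
qed

lemma proj_sym_norm_smult:
  assumes "u \<in> carrier (sym_tensors N X)"
  shows "proj_sym_norm N X (\<lambda>A. a * u A) = norm a * proj_sym_norm N X u"
proof (cases "a = 0")
  case True
  then show ?thesis
    using proj_sym_norm_smult_le[OF assms, of 0] proj_sym_norm_nonneg[OF smult_in_sym_tensors[OF assms], of 0]
    by simp
next
  case False
  \<comment> \<open>The reverse inequality is the one already known, for the scalar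
    \<open>inverse a\<close> and the tensor \<open>a u\<close>.\<close>
  have "proj_sym_norm N X (\<lambda>A. inverse a * (a * u A)) \<le>
      norm (inverse a) * proj_sym_norm N X (\<lambda>A. a * u A)"
    by (intro proj_sym_norm_smult_le smult_in_sym_tensors assms)
  then have "norm a * proj_sym_norm N X u \<le> proj_sym_norm N X (\<lambda>A. a * u A)"
    using False by (simp add: nonzero_norm_inverse pos_le_divide_eq[symmetric] mult.commute
        flip: mult.assoc) (simp add: field_simps)
  then show ?thesis using proj_sym_norm_smult_le[OF assms, of a] by simp
qed

text \<open>For a form bounded by \<open>C\<close> on the diagonal, the value of \<open>u\<close> is
  at most \<open>C\<close> times its norm and hence 0. Since \<open>A\<close> is arbitrary, the
  estimate is made for a bounded \<open>B\<close> that agrees with \<open>A\<close> at the points of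
  one fixed representation of \<open>u\<close>.\<close>

lemma proj_sym_norm_eq_zeroD:
  assumes u: "u \<in> carrier (sym_tensors N X)" and 0: "proj_sym_norm N X u = 0"
  shows "u = (\<lambda>A. 0)"
proof
  fix A
  obtain n c x where x: "\<And>k. k < n \<Longrightarrow> x k \<in> carrier X" "u = power_comb N X n c x"
    using u by (rule sym_tensorsE) (blast intro: that)
  show "u A = 0"
  proof (cases "A \<in> multilinear_forms N X")
    case True
    have "x ` {..<n} \<subseteq> carrier X" using x(1) by auto
    moreover have "A \<in> multilinear_forms N (X\<lparr>carrier := carrier X\<rparr>)" using True by simp
    ultimately obtain B C where B: "B \<in> multilinear_forms N X"
        "\<And>y. y \<in> x ` {..<n} \<Longrightarrow> B (replicate N y) = A (replicate N y)" "0 \<le> C"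
        "\<And>y. y \<in> carrier X \<Longrightarrow> norm (B (replicate N y)) \<le> C * nrm X y ^ N"
      using bounded_multilinear_extension[OF sep linear_subspace_carrier, of "x ` {..<n}"] by blast
    have "norm (u B) \<le> 0"
    proof (rule field_le_epsilon)
      fix e :: real assume "e > 0"
      then have "e / (C + 1) > 0" using B(3) by simp
      then obtain m d y where d: "unit_rep N X m d y u" "(\<Sum>k<m. norm (d k)) < e / (C + 1)"
        using proj_sym_norm_approx[OF u, of "e / (C + 1)"] 0 by auto
      have "norm (u B) \<le> (\<Sum>k<m. norm (d k * tensor_power N X (y k) B))"
        using d(1) unfolding unit_rep_def power_comb_def by (simp add: norm_sum)
      also have "\<dots> \<le> (\<Sum>k<m. norm (d k) * C)"
      proof (rule sum_mono)
        fix k assume "k \<in> {..<m}"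
        then show "norm (d k * tensor_power N X (y k) B) \<le> norm (d k) * C"
          using d(1) B(1) B(4)[of "y k"]
          by (simp add: unit_rep_def norm_mult tensor_power_apply mult_left_mono)
      qed
      also have "\<dots> = C * (\<Sum>k<m. norm (d k))"
        by (simp add: sum_distrib_left mult.commute)
      also have "\<dots> \<le> C * (e / (C + 1))" using d(2) B(3) by (intro mult_left_mono less_imp_le[OF d(2)])
      also have "\<dots> \<le> e" using B(3) \<open>e > 0\<close> by (intro mult_divide_add_one_le) auto
      finally show "norm (u B) \<le> 0 + e" by simp
    qed
    \<comment> \<open>This uses the fixed representation by \<open>x\<close>, whereas the estimate
      above used cheap representations, at whose points \<open>A\<close> and \<open>B\<close> may
      differ.\<close>
    moreover have "u B = u A"
      using True B(1,2) by (auto simp: x(2) power_comb_def tensor_power_apply)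
    ultimately show ?thesis by simp
  next
    case False
    then show ?thesis by (simp add: x(2) power_comb_def tensor_power_apply)
  qed
qed

lemma normed_space_sym_tensors: "normed_space (sym_tensors N X)"
proof (rule normed_spaceI)
  fix u v assume "u \<in> carrier (sym_tensors N X)" "v \<in> carrier (sym_tensors N X)"
  then show "u \<oplus>\<^bsub>sym_tensors N X\<^esub> v \<in> carrier (sym_tensors N X)"
    by (auto elim!: sym_tensorsE simp: power_comb_add intro!: power_comb_in_sym_tensors)
next
  show "\<zero>\<^bsub>sym_tensors N X\<^esub> \<in> carrier (sym_tensors N X)"
    using power_comb_in_sym_tensors[of 0 undefined X N undefined] by (simp add: power_comb_0)
qed (auto simp: smult_in_sym_tensors algebra_simps proj_sym_norm_eq_zeroD proj_sym_norm_smult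
    proj_sym_norm_triangle)

sublocale T: normed_space "sym_tensors N X"
  by (rule normed_space_sym_tensors)

text \<open>
  The tensor \<open>(y + t g)\<^sup>N\<close> is polynomial in \<open>t\<close>, so Lagrange interpolation at \<open>0, \<dots>, N\<close> writes
  \<open>(y + s g)\<^sup>N - y\<^sup>N\<close> as a combination of the powers \<open>(y + j g)\<^sup>N\<close> with coefficients that tend to \<open>0\<close>
  with \<open>s\<close>.  This replaces the polarization formula.
\<close>

lemma tensor_power_continuous:
  assumes y: "y \<in> carrier X" and "e > 0"
  obtains \<delta> where "\<delta> > 0" "\<And>d. d \<in> carrier X \<Longrightarrow> ndist X d y < \<delta> \<Longrightarrow>
    ndist (sym_tensors N X) (tensor_power N X d) (tensor_power N X y) < e"
proof -
  obtain L :: "nat \<Rightarrow> 'k poly" where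
    L: "\<And>p t. degree p \<le> N \<Longrightarrow> poly p t = (\<Sum>j\<le>N. poly (L j) t * poly p (of_nat j))"
    using Lagrange_interpolation[of N] by blast
  \<comment> \<open>\<open>h s\<close> bounds the norm of the difference uniformly over unit
    directions \<open>g\<close>, because \<open>y + j g\<close> has norm at most
    \<open>nrm X y + j\<close>. It is continuous and vanishes at 0, which yields
    \<open>\<delta>\<close>.\<close>
  define h where "h s = (\<Sum>j\<le>N. norm (poly (L j) (of_real s) - poly (L j) 0) * (nrm X y + real j) ^ N)" for s
  have "isCont h 0" unfolding h_def by (intro continuous_intros)
  moreover have "h 0 = 0" by (simp add: h_def)
  ultimately obtain \<delta> where \<delta>: "\<delta> > 0" "\<And>s. s \<noteq> 0 \<Longrightarrow> norm (s - 0) < \<delta> \<Longrightarrow> norm (h s - h 0) < e"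
    using \<open>e > 0\<close> unfolding isCont_def LIM_eq by force
  show ?thesis
  proof
    fix d assume d: "d \<in> carrier X" "ndist X d y < \<delta>"
    show "ndist (sym_tensors N X) (tensor_power N X d) (tensor_power N X y) < e"
    proof (cases "d = y")
      case True
      then show ?thesis using \<open>e > 0\<close> y by (simp add: tensor_power_in_sym_tensors)
    next
      case False
      define s where "s = ndist X d y"
      have s: "s > 0" using False d y metric.mdist_pos_less by (simp add: s_def)
      define g where "g = of_real (1 / s) \<odot> (d \<oplus> (- 1) \<odot> y)"
      have g: "g \<in> carrier X" "nrm X g = 1"
        using d y s by (auto simp: g_def nrm_smult norm_divide s_def ndist_eq)
      have d_eq: "d = y \<oplus> of_real s \<odot> g"
        using d y s by (simp add: g_def smult_smult add_minus_cancel flip: of_real_mult)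
      define w where "w j = y \<oplus> of_nat j \<odot> g" for j
      have w: "w j \<in> carrier X" "nrm X (w j) \<le> nrm X y + real j" for j
        using y g nrm_triangle[of y "of_nat j \<odot> g"] by (auto simp: w_def nrm_smult)
      have interp: "tensor_power N X (y \<oplus> t \<odot> g) A = (\<Sum>j\<le>N. poly (L j) t * tensor_power N X (w j) A)" for t A
      proof (cases "A \<in> multilinear_forms N X")
        case True
        obtain p where p: "degree p \<le> N" "\<And>t. A (replicate N (y \<oplus> t \<odot> g)) = poly p t"
          using multilinear_line_poly[OF True y g(1), of "[]" N] by auto
        then show ?thesis using L[OF p(1), of t] True by (simp add: tensor_power_apply w_def)
      qed (simp add: tensor_power_apply)
      have "(\<lambda>A. tensor_power N X d A + - 1 * tensor_power N X y A) =
          power_comb N X (Suc N) (\<lambda>j. poly (L j) (of_real s) - poly (L j) 0) w"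
        using interp[of "of_real s"] interp[of 0] y g
        by (auto simp: power_comb_def d_eq left_diff_distrib sum_subtractf lessThan_Suc_atMost
            intro!: ext)
      then have "ndist (sym_tensors N X) (tensor_power N X d) (tensor_power N X y) =
          proj_sym_norm N X (power_comb N X (Suc N) (\<lambda>j. poly (L j) (of_real s) - poly (L j) 0) w)"
        using d y by (simp add: T.ndist_eq tensor_power_in_sym_tensors)
      also have "\<dots> \<le> (\<Sum>j<Suc N. norm (poly (L j) (of_real s) - poly (L j) 0) * nrm X (w j) ^ N)"
        using w by (intro proj_sym_norm_power_comb_le)
      also have "\<dots> \<le> h s"
        unfolding h_def lessThan_Suc_atMost using w nrm_nonneg
        by (intro sum_mono mult_left_mono power_mono) auto
      also have "\<dots> < e" using \<delta>(2)[of s] d(2) s \<open>h 0 = 0\<close> by (simp add: s_def)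
      finally show ?thesis .
    qed
  qed (rule \<delta>(1))
qed

section \<open>Approximation with coefficients and points from dense sets\<close>

lemma ndist_power_comb_le:
  assumes "\<And>k. k < n \<Longrightarrow> x k \<in> carrier X" "\<And>k. k < n \<Longrightarrow> y k \<in> carrier X"
  shows "ndist (sym_tensors N X) (power_comb N X n c x) (power_comb N X n d y) \<le>
    (\<Sum>k<n. ndist (sym_tensors N X) (\<lambda>A. c k * tensor_power N X (x k) A) (\<lambda>A. d k * tensor_power N X (y k) A))"
  using assms
proof (induction n)
  case 0
  then show ?case using T.metric.mdist_zero[OF T.M.zero_closed] by (simp add: power_comb_0)
next
  case (Suc n)
  have "ndist (sym_tensors N X) (power_comb N X (Suc n) c x) (power_comb N X (Suc n) d y) \<le>
      ndist (sym_tensors N X) (power_comb N X n c x) (power_comb N X n d y) +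
      ndist (sym_tensors N X) (\<lambda>A. c n * tensor_power N X (x n) A) (\<lambda>A. d n * tensor_power N X (y n) A)"
    unfolding power_comb_Suc
    using T.ndist_add[of "power_comb N X n c x" "\<lambda>A. c n * tensor_power N X (x n) A"
        "power_comb N X n d y" "\<lambda>A. d n * tensor_power N X (y n) A"] Suc.prems
    by (simp add: power_comb_in_sym_tensors smult_in_sym_tensors tensor_power_in_sym_tensors)
  then show ?case using Suc by fastforce
qed

text \<open>Coefficients and points of one representation of \<open>u\<close> are moved term by
  term. No algebraic closure of \<open>Q\<close> or \<open>D\<close> enters, only their
  density.\<close>

lemma power_comb_dense:
  assumes Q: "\<And>c e. e > 0 \<Longrightarrow> \<exists>q\<in>Q. norm (q - c) < e"
    and D: "D \<subseteq> carrier X" "\<And>y e. y \<in> carrier X \<Longrightarrow> e > 0 \<Longrightarrow> \<exists>d\<in>D. ndist X d y < e"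
    and u: "u \<in> carrier (sym_tensors N X)" and "e > 0"
  shows "\<exists>n q d. (\<forall>k<n. q k \<in> Q \<and> d k \<in> D) \<and> ndist (sym_tensors N X) (power_comb N X n q d) u < e"
proof -
  let ?d = "ndist (sym_tensors N X)"
  obtain n c y where y: "\<And>k. k < n \<Longrightarrow> y k \<in> carrier X" "u = power_comb N X n c y"
    using u by (rule sym_tensorsE) (blast intro: that)
  \<comment> \<open>With \<open>real n + 1\<close> in the denominator, \<open>n\<close> errors of
    size \<open>e'\<close> add up to strictly less than \<open>e\<close>, also for
    \<open>n = 0\<close>.\<close>
  define e' where "e' = e / (real n + 1)"
  have e': "e' > 0" using \<open>e > 0\<close> by (simp add: e'_def)
  have "\<exists>q d. q \<in> Q \<and> d \<in> D \<and>
      ?d (\<lambda>A. q * tensor_power N X d A) (\<lambda>A. c k * tensor_power N X (y k) A) < e'" if k: "k < n" for k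
  proof -
    note [simp] = tensor_power_in_sym_tensors[OF y(1)[OF k]]
    define M where "M = proj_sym_norm N X (tensor_power N X (y k)) + 1"
    have M: "M > 0" using proj_sym_norm_nonneg[of "tensor_power N X (y k)"] by (simp add: M_def)
    obtain q where q: "q \<in> Q" "norm (q - c k) < e' / 2 / M" using Q[of "e' / 2 / M" "c k"] M e' by auto
    \<comment> \<open>The scalar is chosen before the point, because the tolerance for
      \<open>d\<close> depends on \<open>norm q\<close>.\<close>
    have "e' / 2 / (norm q + 1) > 0" using e' by (simp add: add_nonneg_pos)
    then obtain \<delta> where \<delta>: "\<delta> > 0" "\<And>d. d \<in> carrier X \<Longrightarrow> ndist X d (y k) < \<delta> \<Longrightarrow>
        ?d (tensor_power N X d) (tensor_power N X (y k)) < e' / 2 / (norm q + 1)"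
      using tensor_power_continuous[OF y(1)[OF k]] by metis
    obtain d where d: "d \<in> D" "ndist X d (y k) < \<delta>" using D(2)[OF y(1)[OF k] \<delta>(1)] by blast
    then have dX: "d \<in> carrier X" using D by auto
    note [simp] = tensor_power_in_sym_tensors[OF dX]
    have "?d (\<lambda>A. q * tensor_power N X d A) (\<lambda>A. q * tensor_power N X (y k) A) =
        norm q * ?d (tensor_power N X d) (tensor_power N X (y k))"
      using T.ndist_smult[of "tensor_power N X d" "tensor_power N X (y k)" q] by simp
    also have "\<dots> \<le> norm q * (e' / 2 / (norm q + 1))"
      using \<delta>(2)[OF dX d(2)] by (intro mult_left_mono) auto
    also have "\<dots> \<le> e' / 2" using e' by (intro mult_divide_add_one_le) auto
    finally have 1: "?d (\<lambda>A. q * tensor_power N X d A) (\<lambda>A. q * tensor_power N X (y k) A) \<le> e' / 2" .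
    have "?d (\<lambda>A. q * tensor_power N X (y k) A) (\<lambda>A. c k * tensor_power N X (y k) A) =
        proj_sym_norm N X (\<lambda>A. (q - c k) * tensor_power N X (y k) A)"
      by (simp add: T.ndist_eq smult_in_sym_tensors left_diff_distrib)
    also have "\<dots> = norm (q - c k) * proj_sym_norm N X (tensor_power N X (y k))"
      by (simp add: proj_sym_norm_smult)
    also have "\<dots> \<le> norm (q - c k) * M" by (simp add: M_def mult_left_mono)
    also have "\<dots> < e' / 2" using q(2) M by (simp add: field_simps)
    finally have 2: "?d (\<lambda>A. q * tensor_power N X (y k) A) (\<lambda>A. c k * tensor_power N X (y k) A) < e' / 2" .
    have "?d (\<lambda>A. q * tensor_power N X d A) (\<lambda>A. c k * tensor_power N X (y k) A) < e'"
      using T.metric.triangle[of "\<lambda>A. q * tensor_power N X d A" "\<lambda>A. q * tensor_power N X (y k) A"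
          "\<lambda>A. c k * tensor_power N X (y k) A"] 1 2 by (simp add: smult_in_sym_tensors)
    then show ?thesis using q d by blast
  qed
  then obtain q d where qd: "\<And>k. k < n \<Longrightarrow> q k \<in> Q \<and> d k \<in> D \<and>
      ?d (\<lambda>A. q k * tensor_power N X (d k) A) (\<lambda>A. c k * tensor_power N X (y k) A) < e'"
    by metis
  have "?d (power_comb N X n q d) u \<le>
      (\<Sum>k<n. ?d (\<lambda>A. q k * tensor_power N X (d k) A) (\<lambda>A. c k * tensor_power N X (y k) A))"
    unfolding y(2) using y(1) qd D(1) by (intro ndist_power_comb_le) auto
  also have "\<dots> \<le> (\<Sum>k<n. e')" using qd by (intro sum_mono) (auto intro: less_imp_le)
  also have "\<dots> < e" using \<open>e > 0\<close> by (simp add: e'_def field_simps)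
  finally show ?thesis using qd by blast
qed

end

section \<open>Separable subspaces with the same projective symmetric norm\<close>

text \<open>Iterates \<open>G\<close> over all lists from the current stage. A list is finite, so it
  already lies in some stage \<open>F n\<close>, and its image is added in the next.\<close>

lemma countable_closing_off:
  fixes G :: "'a list \<Rightarrow> 'a set"
  assumes "countable D0" "\<And>xs. countable (G xs)"
    and "D0 \<subseteq> C" "\<And>xs. set xs \<subseteq> C \<Longrightarrow> G xs \<subseteq> C"
  shows "\<exists>D. countable D \<and> D0 \<subseteq> D \<and> D \<subseteq> C \<and> (\<forall>xs. set xs \<subseteq> D \<longrightarrow> G xs \<subseteq> D)"
proof -
  define F where "F = rec_nat D0 (\<lambda>_ E. E \<union> (\<Union>xs\<in>lists E. G xs))"
  have F: "F 0 = D0" "F (Suc n) = F n \<union> (\<Union>xs\<in>lists (F n). G xs)" for n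
    by (simp_all add: F_def)
  have "countable (F n)" for n by (induction n) (auto simp: F assms(1,2))
  then have cnt: "countable (\<Union>n. F n)" by (intro countable_UN) auto
  have "F 0 \<subseteq> (\<Union>n. F n)" by (rule UN_upper) simp
  then have sup: "D0 \<subseteq> (\<Union>n. F n)" by (simp add: F(1))
  have "F n \<subseteq> C" for n
  proof (induction n)
    case (Suc n)
    have "G xs \<subseteq> C" if "xs \<in> lists (F n)" for xs
      using that Suc by (intro assms(4)) auto
    then show ?case using Suc by (auto simp: F)
  qed (simp add: F assms(3))
  then have sub: "(\<Union>n. F n) \<subseteq> C" by (intro UN_least)
  have mono: "F n \<subseteq> F m" if "n \<le> m" for n m
    by (rule lift_Suc_mono_le[of F, OF _ that]) (simp add: F(2))
  have "G xs \<subseteq> (\<Union>n. F n)" if xs: "set xs \<subseteq> (\<Union>n. F n)" for xs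
  proof -
    have "\<exists>n. set xs \<subseteq> F n"
      using xs
    proof (induction xs)
      case (Cons x xs)
      then obtain n m where "set xs \<subseteq> F n" "x \<in> F m" by auto
      moreover have "F n \<subseteq> F (max n m)" "F m \<subseteq> F (max n m)" by (simp_all add: mono)
      ultimately have "set (x # xs) \<subseteq> F (max n m)" by auto
      then show ?case by (rule exI)
    qed simp
    then obtain n where "set xs \<subseteq> F n" by blast
    then have "xs \<in> lists (F n)" by (simp add: in_lists_conv_set subset_iff)
    then have "G xs \<subseteq> F (Suc n)" unfolding F(2) by blast
    also have "\<dots> \<subseteq> (\<Union>n. F n)" by (rule UN_upper) simp
    finally show ?thesis .
  qed
  with cnt sup sub show ?thesis by (intro exI[of _ "\<Union>n. F n"] conjI allI impI)
qed

text \<open>The witnesses must lie in \<open>D\<close> itself, while their coefficients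
  \<open>c\<close> range over all scalars: only the vectors decide whether a representation lives in
  the subspace.\<close>

definition norming_set ::
    "nat \<Rightarrow> ('k::real_normed_field, 'a) normed_space \<Rightarrow> 'k set \<Rightarrow> 'a set \<Rightarrow> bool"
  where "norming_set N X Q D \<longleftrightarrow>
    (\<forall>e>0. \<forall>n q d. (\<forall>k<n. q k \<in> Q \<and> d k \<in> D) \<longrightarrow>
      (\<exists>m c x. unit_rep N X m c x (power_comb N X n q d) \<and> (\<forall>k<m. x k \<in> D) \<and>
        (\<Sum>k<m. norm (c k)) < proj_sym_norm N X (power_comb N X n q d) + e))"

text \<open>
  Forms on \<open>X\<close> are in particular forms on a subspace \<open>Y\<close>, so restricting functionals on forms is the
  map of tensors induced by \<open>Y \<subseteq> X\<close>.
\<close>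

definition restrict_tensor ::
    "nat \<Rightarrow> ('k::real_normed_field, 'a) normed_space \<Rightarrow> ('k, 'a) tensor \<Rightarrow> ('k, 'a) tensor"
  where "restrict_tensor N X u = (\<lambda>A. if A \<in> multilinear_forms N X then u A else 0)"

section \<open>The map of tensors induced by a subspace\<close>

locale sym_tensor_subspace = sym_tensor_space X N
  for X :: "('k::real_normed_field, 'a) normed_space" (structure) and N +
  fixes S
  assumes S: "linear_subspace X S"
begin

abbreviation Y :: "('k, 'a) normed_space" where "Y \<equiv> X\<lparr>carrier := S\<rparr>"

lemma SX: "x \<in> S \<Longrightarrow> x \<in> carrier X"
  using S by (auto simp: linear_subspace_def)

text \<open>A functional is a function on the whole type of points, so a functional on
  \<open>X\<close> is one on \<open>Y\<close> as it stands, and separation of points is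
  inherited.\<close>

lemma sym_tensor_space_subspace: "sym_tensor_space Y N"
proof (rule sym_tensor_space.intro)
  show "normed_space Y" by (rule normed_space_subspace[OF S])
  have "bounded_functionals X \<subseteq> bounded_functionals Y"
    using SX by (auto simp: bounded_functionals_def) blast
  then have "functionals_separate Y"
    using sep SX by (simp add: functionals_separate_def) blast
  then show "sym_tensor_space_axioms Y N" using N by (simp add: sym_tensor_space_axioms_def)
qed

sublocale Y: sym_tensor_space Y N
  by (rule sym_tensor_space_subspace)

lemma multilinear_forms_subspace: "A \<in> multilinear_forms N X \<Longrightarrow> A \<in> multilinear_forms N Y"
  using SX unfolding multilinear_forms_def by (auto simp: subset_iff)

lemma restrict_power_comb: "restrict_tensor N X (power_comb N Y n c x) = power_comb N X n c x"
  by (auto simp: restrict_tensor_def power_comb_def tensor_power_apply multilinear_forms_subspace)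

lemma restrict_in_sym_tensors:
  assumes "u \<in> carrier (sym_tensors N Y)" shows "restrict_tensor N X u \<in> carrier (sym_tensors N X)"
proof -
  obtain n c x where x: "\<And>k. k < n \<Longrightarrow> x k \<in> S" "u = power_comb N Y n c x"
    using assms by (rule sym_tensorsE) (auto intro: that)
  then show ?thesis by (simp add: restrict_power_comb power_comb_in_sym_tensors SX)
qed

text \<open>An equality over \<open>X\<close> can be tested only at forms on \<open>X\<close>. A
  form \<open>A\<close> on \<open>Y\<close> is therefore exchanged for a form \<open>B\<close> on
  \<open>X\<close> with the same values at the finitely many points of both sides.\<close>

lemma power_comb_subspace_eqI:
  assumes "\<And>k. k < n \<Longrightarrow> x k \<in> S" "\<And>k. k < m \<Longrightarrow> y k \<in> S"
    and eq: "power_comb N X n c x = power_comb N X m d y"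
  shows "power_comb N Y n c x = power_comb N Y m d y"
proof
  fix A
  show "power_comb N Y n c x A = power_comb N Y m d y A"
  proof (cases "A \<in> multilinear_forms N Y")
    case True
    have T: "finite (x ` {..<n} \<union> y ` {..<m})" "x ` {..<n} \<union> y ` {..<m} \<subseteq> S"
      using assms(1,2) by auto
    obtain B where B: "B \<in> multilinear_forms N X"
        "\<And>z. z \<in> x ` {..<n} \<union> y ` {..<m} \<Longrightarrow> B (replicate N z) = A (replicate N z)"
      by (rule bounded_multilinear_extension[OF sep S T True]) (rule that)
    have "power_comb N Y n c x A = power_comb N X n c x B"
      unfolding power_comb_def using True B(1) B(2)[of "x k" for k]
      by (intro sum.cong) (simp_all add: tensor_power_apply)
    also have "\<dots> = power_comb N X m d y B" by (simp only: eq)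
    also have "\<dots> = power_comb N Y m d y A"
      unfolding power_comb_def using True B(1) B(2)[of "y k" for k]
      by (intro sum.cong) (simp_all add: tensor_power_apply)
    finally show ?thesis .
  qed (simp add: power_comb_def tensor_power_apply)
qed

lemma proj_sym_norm_restrict_le:
  assumes "u \<in> carrier (sym_tensors N Y)"
  shows "proj_sym_norm N X (restrict_tensor N X u) \<le> proj_sym_norm N Y u"
proof (rule field_le_epsilon)
  fix e :: real assume "e > 0"
  then obtain n c x where 1: "unit_rep N Y n c x u" "(\<Sum>k<n. norm (c k)) < proj_sym_norm N Y u + e"
    using Y.proj_sym_norm_approx[OF assms] by metis
  then have "unit_rep N X n c x (restrict_tensor N X u)"
    using SX by (simp add: unit_rep_def restrict_power_comb)
  from proj_sym_norm_le[OF this]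
  show "proj_sym_norm N X (restrict_tensor N X u) \<le> proj_sym_norm N Y u + e"
    using 1(2) by simp
qed

lemma ndist_restrict:
  assumes "u \<in> carrier (sym_tensors N Y)" "v \<in> carrier (sym_tensors N Y)"
  shows "ndist (sym_tensors N X) (restrict_tensor N X u) (restrict_tensor N X v) =
    proj_sym_norm N X (restrict_tensor N X (\<lambda>A. u A + - 1 * v A))"
proof -
  have "restrict_tensor N X (\<lambda>A. u A + - 1 * v A) =
      (\<lambda>A. restrict_tensor N X u A + - 1 * restrict_tensor N X v A)"
    by (auto simp: restrict_tensor_def)
  then show ?thesis using T.ndist_eq[OF restrict_in_sym_tensors restrict_in_sym_tensors] assms by simp
qed

lemma proj_sym_norm_restrict:
  assumes Q: "\<And>c e. e > 0 \<Longrightarrow> \<exists>q\<in>Q. norm (q - c) < e"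
    and D: "D \<subseteq> S" "\<And>y e. y \<in> S \<Longrightarrow> e > 0 \<Longrightarrow> \<exists>d\<in>D. ndist X d y < e"
    and rep: "norming_set N X Q D"
    and u: "u \<in> carrier (sym_tensors N Y)"
  shows "proj_sym_norm N X (restrict_tensor N X u) = proj_sym_norm N Y u"
proof (rule antisym[OF proj_sym_norm_restrict_le[OF u]], rule field_le_epsilon)
  fix e :: real assume "e > 0"
  \<comment> \<open>One third pays for near optimality of the representation, two for replacing
    \<open>u\<close> by a nearby tensor: once in the norm over \<open>Y\<close> and once over
    \<open>X\<close>, where restriction does not increase the distance.\<close>
  then have e3: "e / 3 > 0" by simp
  have D_dense: "\<exists>d\<in>D. ndist Y d y < r" if "y \<in> carrier Y" "r > 0" for y r
    using D(2)[of y r] ndist_subspace[OF S, of _ y] D(1) that by force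
  have DY: "D \<subseteq> carrier Y" using D(1) by simp
  have "\<exists>n q d. (\<forall>k<n. q k \<in> Q \<and> d k \<in> D) \<and>
      ndist (sym_tensors N Y) (power_comb N Y n q d) u < e / 3"
    by (rule Y.power_comb_dense[OF Q DY D_dense u e3])
  then obtain n q d where nqd: "\<forall>k<n. q k \<in> Q \<and> d k \<in> D"
      and dist: "ndist (sym_tensors N Y) (power_comb N Y n q d) u < e / 3" by (elim exE conjE)
  have qd: "q k \<in> Q" "d k \<in> D" if "k < n" for k using nqd that by auto
  let ?v = "power_comb N Y n q d"
  have v: "?v \<in> carrier (sym_tensors N Y)"
    using qd(2) D(1) by (intro power_comb_in_sym_tensors) auto
  have "\<exists>m c x. unit_rep N X m c x (power_comb N X n q d) \<and> (\<forall>k<m. x k \<in> D) \<and>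
      (\<Sum>k<m. norm (c k)) < proj_sym_norm N X (power_comb N X n q d) + e / 3"
    using rep nqd e3 unfolding norming_set_def by blast
  then obtain m c x where x: "unit_rep N X m c x (power_comb N X n q d)" "\<forall>k<m. x k \<in> D"
      "(\<Sum>k<m. norm (c k)) < proj_sym_norm N X (power_comb N X n q d) + e / 3" by (elim exE conjE)
  \<comment> \<open>The decisive point: the cheap representation was found over \<open>X\<close>,
    but its vectors lie in \<open>D\<close>, so the equality descends and it competes in the infimum
    over \<open>Y\<close>.\<close>
  have "?v = power_comb N Y m c x"
    using x(1,2) qd(2) D(1) by (intro power_comb_subspace_eqI) (auto simp: unit_rep_def)
  then have "unit_rep N Y m c x ?v"
    using x(1,2) D(1) by (auto simp: unit_rep_def)
  then have "proj_sym_norm N Y ?v \<le> proj_sym_norm N X (restrict_tensor N X ?v) + e / 3"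
    using proj_sym_norm_le[of N Y m c x ?v] x(3) by (simp add: restrict_power_comb)
  moreover have "ndist (sym_tensors N X) (restrict_tensor N X ?v) (restrict_tensor N X u) \<le>
      ndist (sym_tensors N Y) ?v u"
  proof -
    have "(\<lambda>A. ?v A + - 1 * u A) \<in> carrier (sym_tensors N Y)"
      using Y.T.M.a_closed[OF v Y.T.smult_in_carrier[OF u, of "- 1"]] by simp
    from proj_sym_norm_restrict_le[OF this] show ?thesis
      using Y.T.ndist_eq[OF v u] by (simp add: ndist_restrict[OF v u])
  qed
  moreover have "proj_sym_norm N X (restrict_tensor N X ?v) - proj_sym_norm N X (restrict_tensor N X u) \<le>
      ndist (sym_tensors N X) (restrict_tensor N X ?v) (restrict_tensor N X u)"
    using T.nrm_diff_le_ndist[OF restrict_in_sym_tensors[OF v] restrict_in_sym_tensors[OF u]] by simp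
  moreover have "proj_sym_norm N Y u - proj_sym_norm N Y ?v \<le> ndist (sym_tensors N Y) ?v u"
    using Y.T.nrm_diff_le_ndist[OF v u] by simp
  ultimately show "proj_sym_norm N Y u \<le> proj_sym_norm N X (restrict_tensor N X u) + e"
    using dist by linarith
qed

text \<open>\<open>J\<close> extends restriction to the completions. The partial sums over
  \<open>Y\<close> go to the partial sums over \<open>X\<close> with the same \<open>c\<close> and
  \<open>x\<close>, and distances and norms are unchanged. The second property lets
  \<open>J z\<close> be compared with an algebraic tensor over \<open>X\<close> whose points lie in
  \<open>S\<close>.\<close>

lemma norm_attaining_subspace:
  assumes iso: "\<And>u. u \<in> carrier (sym_tensors N Y) \<Longrightarrow>
    proj_sym_norm N X (restrict_tensor N X u) = proj_sym_norm N Y u"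
  obtains J where "\<And>z. z \<in> norm_attaining N Y \<Longrightarrow> J z \<in> norm_attaining N X"
    "\<And>z n c x. z \<in> carrier (proj_sym_tensor N Y) \<Longrightarrow> (\<And>k. k < n \<Longrightarrow> x k \<in> S) \<Longrightarrow>
      ndist (proj_sym_tensor N X) (J z) (to_completion (sym_tensors N X) (power_comb N X n c x)) =
      ndist (proj_sym_tensor N Y) z (to_completion (sym_tensors N Y) (power_comb N Y n c x))"
proof -
  have iso': "ndist (sym_tensors N X) (restrict_tensor N X u) (restrict_tensor N X v) =
      ndist (sym_tensors N Y) u v"
    if "u \<in> carrier (sym_tensors N Y)" "v \<in> carrier (sym_tensors N Y)" for u v
  proof -
    have "(\<lambda>A. u A + - 1 * v A) \<in> carrier (sym_tensors N Y)"
      using Y.T.M.a_closed[OF that(1) Y.T.smult_in_carrier[OF that(2), of "- 1"]] by simp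
    then show ?thesis using iso Y.T.ndist_eq[OF that] by (simp add: ndist_restrict[OF that])
  qed
  obtain J where J:
    "\<And>z. z \<in> carrier (proj_sym_tensor N Y) \<Longrightarrow> J z \<in> carrier (proj_sym_tensor N X)"
    "\<And>z. z \<in> carrier (proj_sym_tensor N Y) \<Longrightarrow>
      nrm (proj_sym_tensor N X) (J z) = nrm (proj_sym_tensor N Y) z"
    "\<And>z w. z \<in> carrier (proj_sym_tensor N Y) \<Longrightarrow> w \<in> carrier (proj_sym_tensor N Y) \<Longrightarrow>
      ndist (proj_sym_tensor N X) (J z) (J w) = ndist (proj_sym_tensor N Y) z w"
    "\<And>u. u \<in> carrier (sym_tensors N Y) \<Longrightarrow>
      J (to_completion (sym_tensors N Y) u) = to_completion (sym_tensors N X) (restrict_tensor N X u)"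
    unfolding proj_sym_tensor_def
    by (rule completion_isometry[OF Y.T.normed_space_axioms T.normed_space_axioms,
          of "restrict_tensor N X"])
      (auto simp: restrict_in_sym_tensors iso' iso)
  have tc: "to_completion (sym_tensors N Y) (power_comb N Y n c x) \<in> carrier (proj_sym_tensor N Y)"
    "J (to_completion (sym_tensors N Y) (power_comb N Y n c x)) =
      to_completion (sym_tensors N X) (power_comb N X n c x)"
    if "\<And>k. k < n \<Longrightarrow> x k \<in> S" for n c x
  proof -
    have *: "power_comb N Y n c x \<in> carrier (sym_tensors N Y)"
      using that by (intro power_comb_in_sym_tensors) simp
    show "to_completion (sym_tensors N Y) (power_comb N Y n c x) \<in> carrier (proj_sym_tensor N Y)"
      unfolding proj_sym_tensor_def by (rule Y.T.to_completion_in_carrier[OF *])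
    show "J (to_completion (sym_tensors N Y) (power_comb N Y n c x)) =
        to_completion (sym_tensors N X) (power_comb N X n c x)"
      using J(4)[OF *] by (simp add: restrict_power_comb)
  qed
  interpret CX: normed_space "proj_sym_tensor N X"
    unfolding proj_sym_tensor_def by (rule T.normed_space_completion)
  interpret CY: normed_space "proj_sym_tensor N Y"
    unfolding proj_sym_tensor_def by (rule Y.T.normed_space_completion)
  show ?thesis
  proof
    fix z assume "z \<in> norm_attaining N Y"
    then obtain c x where z: "z \<in> carrier (proj_sym_tensor N Y)" "bounded (range c)"
        "\<And>n. x n \<in> S \<and> nrm X (x n) \<le> 1"
        "limitin (norm_topology (proj_sym_tensor N Y))
          (\<lambda>n. to_completion (sym_tensors N Y) (power_comb N Y n c x)) z sequentially"
        "(\<lambda>n. norm (c n)) sums nrm (proj_sym_tensor N Y) z"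
      by (auto simp: norm_attaining_def)
    have mem: "to_completion (sym_tensors N Y) (power_comb N Y n c x) \<in> carrier (proj_sym_tensor N Y)"
      and eq: "J (to_completion (sym_tensors N Y) (power_comb N Y n c x)) =
        to_completion (sym_tensors N X) (power_comb N X n c x)" for n
      using z(3) by (simp_all add: tc)
    have memX: "to_completion (sym_tensors N X) (power_comb N X n c x) \<in> carrier (proj_sym_tensor N X)"
      and dist: "ndist (proj_sym_tensor N X) (to_completion (sym_tensors N X) (power_comb N X n c x)) (J z) =
        ndist (proj_sym_tensor N Y) (to_completion (sym_tensors N Y) (power_comb N Y n c x)) z" for n
      using J(1)[OF mem[of n]] J(3)[OF mem[of n] z(1)] by (simp_all only: eq)
    have "limitin (norm_topology (proj_sym_tensor N X))
        (\<lambda>n. to_completion (sym_tensors N X) (power_comb N X n c x)) (J z) sequentially"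
      using z(4) J(1)[OF z(1)] memX unfolding CX.limitin_iff_ndist CY.limitin_iff_ndist dist by blast
    then show "J z \<in> norm_attaining N X"
      using z J(1,2) SX by (auto simp: norm_attaining_def intro!: exI[of _ c] exI[of _ x])
  next
    fix z n c and x :: "nat \<Rightarrow> 'a"
    assume "z \<in> carrier (proj_sym_tensor N Y)" "\<And>k. k < n \<Longrightarrow> x k \<in> S"
    then show "ndist (proj_sym_tensor N X) (J z) (to_completion (sym_tensors N X) (power_comb N X n c x)) =
      ndist (proj_sym_tensor N Y) z (to_completion (sym_tensors N Y) (power_comb N Y n c x))"
      using J(3)[of z "to_completion (sym_tensors N Y) (power_comb N Y n c x)"] tc by simp
  qed
qed

end

section \<open>A countable norming set\<close>

context sym_tensor_space
begin

text \<open>All requirements on \<open>D\<close> concern finitely many of its elements at a time, so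
  a single list operation encodes them. Scalars are restricted to \<open>Q\<close> to keep the set
  countable.\<close>

lemma countable_closed_set:
  assumes "countable Q" "countable D0" "D0 \<subseteq> carrier X"
  obtains D where "countable D" "D0 \<subseteq> D" "D \<subseteq> carrier X" "\<zero> \<in> D"
    "\<And>x y. x \<in> D \<Longrightarrow> y \<in> D \<Longrightarrow> x \<oplus> y \<in> D" "\<And>q x. q \<in> Q \<Longrightarrow> x \<in> D \<Longrightarrow> q \<odot> x \<in> D"
    "norming_set N X Q D"
proof -
  \<comment> \<open>Lists make the combinations countable objects. The length is that of
    \<open>xs\<close>; if \<open>qs\<close> is shorter, the remaining coefficients are some
    unspecified scalars.\<close>
  define pc where "pc qs xs = power_comb N X (length xs) ((!) qs) ((!) xs)" for qs :: "'k list" and xs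
  \<comment> \<open>Tolerances run through \<open>1 / (i + 1)\<close>, again for countability. A
    representation is demanded only for points in the carrier, so that a suitable \<open>R\<close>
    exists for all arguments and always stays inside the carrier.\<close>
  define P where "P qs xs i R \<longleftrightarrow> finite R \<and> R \<subseteq> carrier X \<and> (set xs \<subseteq> carrier X \<longrightarrow>
      (\<exists>m c x. unit_rep N X m c x (pc qs xs) \<and> (\<forall>k<m. x k \<in> R) \<and>
        (\<Sum>k<m. norm (c k)) < proj_sym_norm N X (pc qs xs) + 1 / real (Suc i)))" for qs xs i R
  have "\<exists>R. P qs xs i R" for qs xs i
  proof (cases "set xs \<subseteq> carrier X")
    case True
    then have pc: "pc qs xs \<in> carrier (sym_tensors N X)"
      unfolding pc_def by (intro power_comb_in_sym_tensors) (auto simp: subset_iff)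
    have i: "1 / real (Suc i) > 0" by simp
    obtain m c x where x: "unit_rep N X m c x (pc qs xs)"
        "(\<Sum>k<m. norm (c k)) < proj_sym_norm N X (pc qs xs) + 1 / real (Suc i)"
      by (rule proj_sym_norm_approx[OF pc i]) (rule that)
    have "P qs xs i (x ` {..<m})"
      unfolding P_def using x by (intro conjI impI exI[of _ m] exI[of _ c] exI[of _ x]) (auto simp: unit_rep_def)
    then show ?thesis by (rule exI)
  next
    case False
    then have "P qs xs i {}" by (simp add: P_def)
    then show ?thesis by (rule exI)
  qed
  then obtain R where PR: "\<And>qs xs i. P qs xs i (R qs xs i)" by metis
  have R: "finite (R qs xs i)" "R qs xs i \<subseteq> carrier X" for qs xs i
    using PR[of qs xs i] unfolding P_def by simp_all
  \<comment> \<open>The points of a combination are the argument of \<open>G\<close>; coefficient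
    lists and tolerances are absorbed into countable unions.\<close>
  define G where "G xs = insert \<zero> ((\<lambda>(x, y). x \<oplus> y) ` (set xs \<times> set xs) \<union>
    (\<lambda>(q, x). q \<odot> x) ` (Q \<times> set xs) \<union> (\<Union>qs\<in>lists Q. \<Union>i. R qs xs i))" for xs
  have G_countable: "countable (G xs)" for xs
    unfolding G_def using assms(1) R(1)
    by (intro countable_insert countable_Un countable_image countable_SIGMA countable_UN
        countable_lists) (auto intro: countable_finite)
  have G_carrier: "G xs \<subseteq> carrier X" if "set xs \<subseteq> carrier X" for xs
  proof -
    have "(\<Union>qs\<in>lists Q. \<Union>i. R qs xs i) \<subseteq> carrier X" using R(2) by (intro UN_least)
    moreover have "x \<in> carrier X" if "x \<in> set xs" for x using \<open>set xs \<subseteq> carrier X\<close> that by auto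
    ultimately show ?thesis unfolding G_def by auto
  qed
  have "\<exists>D. countable D \<and> D0 \<subseteq> D \<and> D \<subseteq> carrier X \<and> (\<forall>xs. set xs \<subseteq> D \<longrightarrow> G xs \<subseteq> D)"
    by (rule countable_closing_off[OF assms(2) G_countable assms(3) G_carrier])
  then obtain D where D: "countable D" "D0 \<subseteq> D" "D \<subseteq> carrier X"
      and "\<forall>xs. set xs \<subseteq> D \<longrightarrow> G xs \<subseteq> D" by (elim exE conjE)
  then have DG: "G xs \<subseteq> D" if "set xs \<subseteq> D" for xs using that by simp
  show ?thesis
  proof
    show "\<zero> \<in> D" using DG[of "[]"] by (auto simp: G_def)
    show "x \<oplus> y \<in> D" if "x \<in> D" "y \<in> D" for x y
      using DG[of "[x, y]"] that by (auto simp: G_def)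
    show "q \<odot> x \<in> D" if "q \<in> Q" "x \<in> D" for q x
      using DG[of "[x]"] that by (auto simp: G_def)
    show "norming_set N X Q D"
      unfolding norming_set_def
    proof (intro allI impI)
      fix e :: real and n :: nat and q d
      assume "e > 0" and "\<forall>k<n. q k \<in> Q \<and> d k \<in> D"
      then have q: "\<And>k. k < n \<Longrightarrow> q k \<in> Q" and d: "\<And>k. k < n \<Longrightarrow> d k \<in> D" by auto
      define qs where "qs = map q [0..<n]"
      define ds where "ds = map d [0..<n]"
      have eq: "pc qs ds = power_comb N X n q d"
        by (simp add: pc_def qs_def ds_def power_comb_def)
      have "set ds \<subseteq> D" using d by (auto simp: ds_def)
      obtain i where i: "1 / real (Suc i) < e" using \<open>e > 0\<close> nat_approx_posE by metis
      have "set ds \<subseteq> carrier X" using \<open>set ds \<subseteq> D\<close> D(3) by blast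
      then obtain m c x where x: "unit_rep N X m c x (pc qs ds)" "\<forall>k<m. x k \<in> R qs ds i"
          "(\<Sum>k<m. norm (c k)) < proj_sym_norm N X (pc qs ds) + 1 / real (Suc i)"
        using PR[of qs ds i] unfolding P_def by auto
      have "qs \<in> lists Q" using q by (auto simp: qs_def)
      then have "R qs ds i \<subseteq> (\<Union>qs\<in>lists Q. \<Union>i. R qs ds i)" by fast
      also have "\<dots> \<subseteq> G ds" by (auto simp: G_def)
      also have "\<dots> \<subseteq> D" by (rule DG[OF \<open>set ds \<subseteq> D\<close>])
      finally have "\<forall>k<m. x k \<in> D" using x(2) by auto
      moreover have "(\<Sum>k<m. norm (c k)) < proj_sym_norm N X (pc qs ds) + e" using x(3) i by simp
      ultimately have "unit_rep N X m c x (power_comb N X n q d) \<and> (\<forall>k<m. x k \<in> D) \<and>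
          (\<Sum>k<m. norm (c k)) < proj_sym_norm N X (power_comb N X n q d) + e"
        using x(1) unfolding eq by (intro conjI)
      then show "\<exists>m c x. unit_rep N X m c x (power_comb N X n q d) \<and> (\<forall>k<m. x k \<in> D) \<and>
          (\<Sum>k<m. norm (c k)) < proj_sym_norm N X (power_comb N X n q d) + e" by (intro exI)
    qed
  qed (fact D)+
qed

end

section \<open>Closures of countable sets\<close>

context normed_space
begin

lemma closure_of_eq_carrier_iff:
  assumes "A \<subseteq> carrier X"
  shows "norm_topology X closure_of A = carrier X \<longleftrightarrow>
    (\<forall>z\<in>carrier X. \<forall>e>0. \<exists>w\<in>A. ndist X z w < e)"
proof -
  have "(\<exists>w\<in>A. w \<in> metric.mball z e) \<longleftrightarrow> (\<exists>w\<in>A. ndist X z w < e)" if "z \<in> carrier X" for z e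
    using that assms by (auto simp: metric.in_mball)
  then have "norm_topology X closure_of A = {z \<in> carrier X. \<forall>e>0. \<exists>w\<in>A. ndist X z w < e}"
    unfolding metric.metric_closure_of by blast
  then show ?thesis by blast
qed

text \<open>Sums follow from continuity of addition. For an arbitrary scalar \<open>c\<close>, both
  \<open>c\<close> and \<open>y\<close> are approximated: \<open>q \<odot> d\<close> lies in
  \<open>D\<close>, and the intermediate point \<open>q \<odot> y\<close> separates the two
  errors.\<close>

lemma linear_subspace_closure:
  assumes Q: "\<And>c e. e > 0 \<Longrightarrow> \<exists>q\<in>Q. norm (q - c) < e"
    and D: "D \<subseteq> carrier X" "\<zero> \<in> D" "\<And>x y. x \<in> D \<Longrightarrow> y \<in> D \<Longrightarrow> x \<oplus> y \<in> D"
      "\<And>q x. q \<in> Q \<Longrightarrow> x \<in> D \<Longrightarrow> q \<odot> x \<in> D"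
  shows "linear_subspace X {y \<in> carrier X. \<forall>e>0. \<exists>d\<in>D. ndist X d y < e}"
  unfolding linear_subspace_def
proof (intro conjI ballI allI)
  have "\<exists>d\<in>D. ndist X d \<zero> < e" if "e > 0" for e using D(2) that by (intro bexI[of _ "\<zero>"]) auto
  then show "\<zero> \<in> {y \<in> carrier X. \<forall>e>0. \<exists>d\<in>D. ndist X d y < e}" by simp
next
  fix x y
  assume x: "x \<in> {y \<in> carrier X. \<forall>e>0. \<exists>d\<in>D. ndist X d y < e}"
    and y: "y \<in> {y \<in> carrier X. \<forall>e>0. \<exists>d\<in>D. ndist X d y < e}"
  have "\<exists>d\<in>D. ndist X d (x \<oplus> y) < e" if "e > 0" for e
  proof -
    have "\<exists>d\<in>D. ndist X d x < e / 2" "\<exists>d\<in>D. ndist X d y < e / 2"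
      using x y half_gt_zero[OF \<open>e > 0\<close>] by blast+
    then obtain a b where ab: "a \<in> D" "ndist X a x < e / 2" "b \<in> D" "ndist X b y < e / 2"
      by (elim bexE)
    have "ndist X (a \<oplus> b) (x \<oplus> y) \<le> ndist X a x + ndist X b y"
      using ab x y D(1) by (intro ndist_add) auto
    then show ?thesis using ab D(3) by (intro bexI[of _ "a \<oplus> b"]) auto
  qed
  then show "x \<oplus> y \<in> {y \<in> carrier X. \<forall>e>0. \<exists>d\<in>D. ndist X d y < e}" using x y by simp
next
  fix c y
  assume y: "y \<in> {y \<in> carrier X. \<forall>e>0. \<exists>d\<in>D. ndist X d y < e}"
  have "\<exists>d\<in>D. ndist X d (c \<odot> y) < e" if "e > 0" for e
  proof -
    have nn: "nrm X y \<ge> 0" using y nrm_nonneg by simp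
    have "e / 2 / (nrm X y + 1) > 0" using \<open>e > 0\<close> nn by simp
    then obtain q where q: "q \<in> Q" "norm (q - c) < e / 2 / (nrm X y + 1)" using Q by blast
    have "e / 2 / (norm q + 1) > 0" using \<open>e > 0\<close> by (simp add: add_nonneg_pos)
    then obtain d where d: "d \<in> D" "ndist X d y < e / 2 / (norm q + 1)" using y by blast
    have c: "d \<in> carrier X" "y \<in> carrier X" using d D y by auto
    have "ndist X (q \<odot> d) (q \<odot> y) \<le> norm q * (e / 2 / (norm q + 1))"
      using d c by (simp only: ndist_smult) (intro mult_left_mono, auto)
    also have "\<dots> \<le> e / 2" using \<open>e > 0\<close> by (intro mult_divide_add_one_le) auto
    finally have 1: "ndist X (q \<odot> d) (q \<odot> y) \<le> e / 2" .
    have "ndist X (q \<odot> y) (c \<odot> y) = norm (q - c) * nrm X y"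
      using c smult_add_left[of y q "- c"] by (simp add: ndist_eq smult_smult flip: nrm_smult)
    also have "\<dots> \<le> norm (q - c) * (nrm X y + 1)" by (simp add: mult_left_mono)
    also have "\<dots> < e / 2" using q(2) nn by (simp add: pos_less_divide_eq algebra_simps)
    finally have "ndist X (q \<odot> d) (c \<odot> y) < e"
      using metric.triangle[of "q \<odot> d" "q \<odot> y" "c \<odot> y"] 1 c by simp
    then show ?thesis using D(4)[OF q(1) d(1)] by blast
  qed
  then show "c \<odot> y \<in> {y \<in> carrier X. \<forall>e>0. \<exists>d\<in>D. ndist X d y < e}" using y by simp
qed auto

text \<open>The subspace has the distances of \<open>X\<close>, so a Cauchy sequence in it converges
  in \<open>X\<close>; the limit is approximated by points of the sequence and these by points of
  \<open>D\<close>. Density of \<open>D\<close> is the definition of \<open>S\<close>.\<close>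

lemma banach_separable_closure:
  assumes "banach_space X" "countable D" "D \<subseteq> carrier X"
  defines "S \<equiv> {y \<in> carrier X. \<forall>e>0. \<exists>d\<in>D. ndist X d y < e}"
  assumes S: "linear_subspace X S"
  shows "banach_space (X\<lparr>carrier := S\<rparr>)" "separable_space (norm_topology (X\<lparr>carrier := S\<rparr>))"
proof -
  let ?Y = "X\<lparr>carrier := S\<rparr>"
  interpret Y: normed_space ?Y by (rule normed_space_subspace[OF S])
  have SX: "x \<in> carrier X" if "x \<in> S" for x using that by (simp add: S_def)
  have DS: "D \<subseteq> S" using assms(3) by (force simp: S_def)
  have "Metric_space.mcomplete (carrier ?Y) (ndist ?Y)"
    unfolding Y.metric.mcomplete_def
  proof (intro allI impI)
    fix s assume "Y.metric.MCauchy s"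
    then have "range s \<subseteq> S"
        and "\<forall>e>0. \<exists>M. \<forall>m n. M \<le> m \<longrightarrow> M \<le> n \<longrightarrow> ndist ?Y (s m) (s n) < e"
      unfolding Y.metric.MCauchy_def by simp_all
    then have s: "s n \<in> S"
        and "\<forall>e>0. \<exists>M. \<forall>m n. M \<le> m \<longrightarrow> M \<le> n \<longrightarrow> ndist X (s m) (s n) < e" for n
      by (simp_all add: range_subsetD ndist_subspace[OF S])
    then have "metric.MCauchy s" using SX unfolding metric.MCauchy_def by auto
    then obtain l where l: "l \<in> carrier X"
        "\<And>e. e > 0 \<Longrightarrow> \<exists>M. \<forall>n\<ge>M. s n \<in> carrier X \<and> ndist X (s n) l < e"
      using assms(1) unfolding banach_space_def metric.mcomplete_def limitin_iff_ndist by blast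
    have "\<exists>d\<in>D. ndist X d l < e" if "e > 0" for e
    proof -
      obtain n where n: "ndist X (s n) l < e / 2" using l(2)[of "e / 2"] \<open>e > 0\<close> by auto
      obtain d where d: "d \<in> D" "ndist X d (s n) < e / 2"
        using s[of n] \<open>e > 0\<close> half_gt_zero unfolding S_def by blast
      have "ndist X d l < e"
        using metric.triangle[of d "s n" l] n d SX[OF s] l(1) assms(3) by auto
      then show ?thesis using d(1) by blast
    qed
    then have "l \<in> S" using l(1) by (simp add: S_def)
    then show "\<exists>l. limitin (norm_topology ?Y) s l sequentially"
      unfolding Y.limitin_iff_ndist using l(2) s
      by (intro exI[of _ l]) (simp add: ndist_subspace[OF S] SX)
  qed
  then show "banach_space ?Y" using Y.normed_space_axioms by (simp add: banach_space_def)
  have "\<exists>y\<in>D. ndist ?Y x y < r" if xr: "x \<in> S" "r > 0" for x r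
  proof -
    obtain y where y: "y \<in> D" "ndist X y x < r" using xr unfolding S_def by blast
    then have "ndist ?Y x y < r"
      using DS ndist_subspace[OF S xr(1), of y] metric.commute[of x y] by auto
    then show ?thesis using y(1) by blast
  qed
  then have "norm_topology ?Y closure_of D = topspace (norm_topology ?Y)"
    using DS Y.closure_of_eq_carrier_iff[of D] unfolding Y.metric.topspace_mtopology by simp
  then show "separable_space (norm_topology ?Y)"
    using assms(2) DS unfolding separable_space_def Y.metric.topspace_mtopology by auto
qed

end

text \<open>Second countability of the scalars supplies the countable dense set \<open>Q\<close>.
  The subspace is chosen anew for each element of the completion, after an algebraic tensor near it
  has been fixed.\<close>

lemma norm_attaining_dense_of_separable:
  fixes X :: "('k::{real_normed_field, second_countable_topology}, 'a) normed_space"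
  assumes "N \<ge> 1" "banach_space X" "functionals_separate X"
    and separable: "\<And>Y :: ('k, 'a) normed_space. banach_space Y \<Longrightarrow>
      separable_space (norm_topology Y) \<Longrightarrow> norm_attaining_dense N Y"
  shows "norm_attaining_dense N X"
proof -
  interpret sym_tensor_space X N
    using assms(1-3) by (simp add: sym_tensor_space_def sym_tensor_space_axioms_def banach_space_def)
  interpret C: normed_space "proj_sym_tensor N X"
    unfolding proj_sym_tensor_def by (rule T.normed_space_completion)
  obtain Q :: "'k set" where Q: "countable Q" "\<And>U. open U \<Longrightarrow> U \<noteq> {} \<Longrightarrow> \<exists>q\<in>Q. q \<in> U"
    using countable_dense_setE by blast
  have Q_dense: "\<exists>q\<in>Q. norm (q - c) < e" if "e > 0" for c e
    using Q(2)[of "ball c e"] that by (auto simp: dist_norm norm_minus_commute)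
  have "\<exists>w\<in>norm_attaining N X. ndist (proj_sym_tensor N X) z w < e"
    if z: "z \<in> carrier (proj_sym_tensor N X)" and "e > 0" for z e
  proof -
    obtain u where u: "u \<in> carrier (sym_tensors N X)"
        "ndist (proj_sym_tensor N X) (to_completion (sym_tensors N X) u) z < e / 2"
      using T.to_completion_dense[of z "e / 2"] z \<open>e > 0\<close> unfolding proj_sym_tensor_def by auto
    obtain n c x where x: "\<And>k. k < n \<Longrightarrow> x k \<in> carrier X" "u = power_comb N X n c x"
      using u(1) by (rule sym_tensorsE) (blast intro: that)
    \<comment> \<open>Starting the closing off from the points of \<open>u\<close> ensures that
      \<open>u\<close> lives over the subspace.\<close>
    have "countable (x ` {..<n})" "x ` {..<n} \<subseteq> carrier X" using x(1) by auto
    then obtain D where D: "countable D" "x ` {..<n} \<subseteq> D" "D \<subseteq> carrier X" "\<zero>\<^bsub>X\<^esub> \<in> D"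
        "\<And>x y. x \<in> D \<Longrightarrow> y \<in> D \<Longrightarrow> x \<oplus>\<^bsub>X\<^esub> y \<in> D" "\<And>q x. q \<in> Q \<Longrightarrow> x \<in> D \<Longrightarrow> q \<odot>\<^bsub>X\<^esub> x \<in> D"
        "norming_set N X Q D"
      by (rule countable_closed_set[OF Q(1)]) (rule that)
    define S where "S = {y \<in> carrier X. \<forall>e>0. \<exists>d\<in>D. ndist X d y < e}"
    have S: "linear_subspace X S"
      unfolding S_def by (rule linear_subspace_closure[OF Q_dense D(3-6)])
    interpret sym_tensor_subspace X N S
      by unfold_locales (rule S)
    interpret CY: normed_space "proj_sym_tensor N Y"
      unfolding proj_sym_tensor_def by (rule Y.T.normed_space_completion)
    have DS: "D \<subseteq> S" using D(3) by (force simp: S_def)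
    have "norm_attaining_dense N Y"
      using banach_separable_closure[OF assms(2) D(1,3)] S unfolding S_def by (intro separable)
    have dense: "\<exists>w\<in>norm_attaining N Y. ndist (proj_sym_tensor N Y) w v < e / 2"
      if v: "v \<in> carrier (proj_sym_tensor N Y)" for v
    proof -
      have "norm_attaining N Y \<subseteq> carrier (proj_sym_tensor N Y)" by (auto simp: norm_attaining_def)
      then have "\<exists>w\<in>norm_attaining N Y. ndist (proj_sym_tensor N Y) v w < e / 2"
        using \<open>norm_attaining_dense N Y\<close> v half_gt_zero[OF \<open>e > 0\<close>]
        unfolding norm_attaining_dense_def by (simp only: CY.closure_of_eq_carrier_iff)
      then show ?thesis by (simp only: CY.metric.commute[of v])
    qed
    have iso: "proj_sym_norm N X (restrict_tensor N X v) = proj_sym_norm N Y v"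
      if "v \<in> carrier (sym_tensors N Y)" for v
      by (rule proj_sym_norm_restrict[OF Q_dense DS _ D(7) that]) (auto simp: S_def)
    obtain J where J: "\<And>z. z \<in> norm_attaining N Y \<Longrightarrow> J z \<in> norm_attaining N X"
      "\<And>z n c x. z \<in> carrier (proj_sym_tensor N Y) \<Longrightarrow> (\<And>k. k < n \<Longrightarrow> x k \<in> S) \<Longrightarrow>
        ndist (proj_sym_tensor N X) (J z) (to_completion (sym_tensors N X) (power_comb N X n c x)) =
        ndist (proj_sym_tensor N Y) z (to_completion (sym_tensors N Y) (power_comb N Y n c x))"
      by (rule norm_attaining_subspace[OF iso]) (auto intro: that)
    have xS: "x k \<in> S" if "k < n" for k using that D(2) DS by auto
    have "power_comb N Y n c x \<in> carrier (sym_tensors N Y)"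
      using xS by (intro power_comb_in_sym_tensors) simp
    then have "to_completion (sym_tensors N Y) (power_comb N Y n c x) \<in> carrier (proj_sym_tensor N Y)"
      unfolding proj_sym_tensor_def by (rule Y.T.to_completion_in_carrier)
    \<comment> \<open>The tensor \<open>u\<close>, read over \<open>Y\<close>, is approximated there
      by \<open>w\<close>; \<open>J\<close> moves \<open>w\<close> to the space over
      \<open>X\<close> without changing the distance to \<open>u\<close>. The other half of
      \<open>e\<close> was spent on the distance from \<open>u\<close> to \<open>z\<close>.\<close>
    then obtain w where w: "w \<in> norm_attaining N Y" "ndist (proj_sym_tensor N Y) w
        (to_completion (sym_tensors N Y) (power_comb N Y n c x)) < e / 2"
      using dense by blast
    have wY: "w \<in> carrier (proj_sym_tensor N Y)" using w(1) by (simp add: norm_attaining_def)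
    have "ndist (proj_sym_tensor N X) (J w) (to_completion (sym_tensors N X) u) < e / 2"
      using w(2) J(2)[OF wY xS] x(2) by simp
    moreover have "to_completion (sym_tensors N X) u \<in> carrier (proj_sym_tensor N X)"
      unfolding proj_sym_tensor_def by (rule T.to_completion_in_carrier[OF u(1)])
    moreover have "J w \<in> carrier (proj_sym_tensor N X)"
      using J(1)[OF w(1)] by (simp add: norm_attaining_def)
    ultimately have "ndist (proj_sym_tensor N X) z (J w) < e"
      using C.metric.triangle[of "J w" "to_completion (sym_tensors N X) u" z] u(2) z
        C.metric.commute[of z] by simp
    then show ?thesis using J(1)[OF w(1)] by blast
  qed
  moreover have "norm_attaining N X \<subseteq> carrier (proj_sym_tensor N X)"
    by (auto simp: norm_attaining_def)
  ultimately show ?thesis by (simp add: norm_attaining_dense_def C.closure_of_eq_carrier_iff)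
qed

theorem theorem3p13:
  fixes N :: nat
  assumes "N \<ge> 1"
  shows
    "((\<forall>Y :: (real, 'a) normed_space.
          banach_space Y \<and> separable_space (norm_topology Y) \<longrightarrow> norm_attaining_dense N Y)
        \<longrightarrow> (\<forall>X :: (real, 'a) normed_space. banach_space X \<longrightarrow> norm_attaining_dense N X))
     \<and>
     ((\<forall>Y :: (complex, 'a) normed_space.
          banach_space Y \<and> separable_space (norm_topology Y) \<longrightarrow> norm_attaining_dense N Y)
        \<longrightarrow> (\<forall>X :: (complex, 'a) normed_space. banach_space X \<longrightarrow> norm_attaining_dense N X))"
proof (intro conjI impI allI)
  fix X :: "(real, 'a) normed_space"
  assume hyp: "\<forall>Y :: (real, 'a) normed_space.
    banach_space Y \<and> separable_space (norm_topology Y) \<longrightarrow> norm_attaining_dense N Y"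
    and X: "banach_space X"
  then have "functionals_separate X"
    by (intro functionals_separate_real) (simp add: banach_space_def)
  then show "norm_attaining_dense N X"
    by (rule norm_attaining_dense_of_separable[OF assms X]) (simp add: hyp)
next
  fix X :: "(complex, 'a) normed_space"
  assume hyp: "\<forall>Y :: (complex, 'a) normed_space.
    banach_space Y \<and> separable_space (norm_topology Y) \<longrightarrow> norm_attaining_dense N Y"
    and X: "banach_space X"
  then have "functionals_separate X"
    by (intro functionals_separate_complex) (simp add: banach_space_def)
  then show "norm_attaining_dense N X"
    by (rule norm_attaining_dense_of_separable[OF assms X]) (simp add: hyp)
qed

end
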